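(* Let $\mathcal{C}$ be a Barr-exact protomodular category with a fixed class $\mathcal{Z}$ of zero objects. Let $(\mathcal{T},\mathcal{F})$ be a $\mathcal{Z}$-torsion theory in $\mathcal{C}$ satisfying Conditions (S), (M') and (P). Let $f$ be an effective descent morphism in $\mathcal{C}$ (i.e. a regular epimorphism, since $\mathcal{C}$ is Barr-exact), and let $\Gamma=(\mathsf{F},\mathsf{i},\mathrm{Arr}(\mathcal{C}),\mathrm{Arr}(\mathcal{F}))$ be the Galois structure associated with the reflector $\mathsf{F}\colon\mathcal{C}\to\mathcal{F}$, where $\mathsf{i}\colon\mathcal{F}\hookrightarrow\mathcal{C}$ is the inclusion. Then the following conditions are equivalent: (a) $f$ is a normal extension for $\Gamma$; (b) $f$ is a central extension for $\Gamma$; (c) $K[f]\in\mathcal{F}$.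
   Context: A category is protomodular if it has pullbacks of split epimorphisms along any arrow and, whenever a split epimorphism $p\colon C\to B$ with section $s$ is pulled back along $f\colon A\to B$, giving $g\colon A\times_B C\to C$, the pair $(g,s)$ is jointly extremally epimorphic. A class of zero objects in a category $\mathcal{C}$ is a full subcategory $\mathcal{Z}$ (taken closed under isomorphism) which is posetal (at most one morphism between any two of its objects), monocoreflective (the inclusion has a right adjoint $\mathsf{Z}$, the coreflector, with every counit component $\varepsilon_A\colon\mathsf{Z}(A)\to A$ a monomorphism), and such that $\mathsf{Z}(m)$ is an isomorphism for every monomorphism $m$ of $\mathcal{C}$. An arrow $f$ is inverted by $\mathsf{Z}$ if $\mathsf{Z}(f)$ is an isomorphism. $\mathcal{N}_{\mathcal{Z}}$ denotes the class of arrows of $\mathcal{C}$ factoring through an object of $\mathcal{Z}$. A $\mathcal{Z}$-kernel of $f\colon A\to B$ is an arrow $k\colon K\to A$ with $fk\in\mathcal{N}_{\mathcal{Z}}$ such that every $e\colon E\to A$ with $fe\in\mathcal{N}_{\mathcal{Z}}$ factors uniquely through $k$; $\mathcal{Z}$-cokernels are defined dually. In a category with pullbacks the $\mathcal{Z}$-kernel of $f$ exists (it is the pullback of $\varepsilon_B$ along $f$); its domain is denoted $K[f]$. A sequence $A\xrightarrow{f}B\xrightarrow{g}C$ is short $\mathcal{Z}$-exact if $f$ is a $\mathcal{Z}$-kernel of $g$ and $g$ is a $\mathcal{Z}$-cokernel of $f$. A $\mathcal{Z}$-torsion theory is a pair $(\mathcal{T},\mathcal{F})$ of full replete subcategories of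 $\mathcal{C}$ such that: $\mathcal{T}\cap\mathcal{F}=\mathcal{Z}$; every arrow $T\to F$ with $T\in\mathcal{T}$, $F\in\mathcal{F}$ lies in $\mathcal{N}_{\mathcal{Z}}$; for every $A\in\mathcal{C}$ there is a short $\mathcal{Z}$-exact sequence $\mathsf{T}(A)\xrightarrow{t_A}A\xrightarrow{\eta_A}\mathsf{F}(A)$ with $\mathsf{T}(A)\in\mathcal{T}$, $\mathsf{F}(A)\in\mathcal{F}$ (unique up to isomorphism). The assignment $\mathsf{F}$ extends to a functor $\mathcal{C}\to\mathcal{F}$ left adjoint to the inclusion, with unit $\eta$. If $T\in\mathcal{T}$ then $\mathsf{F}(T)\in\mathcal{Z}$. Condition (M'): for every object $A$ of $\mathcal{C}$, $\mathsf{F}(\mathsf{T}(A))\cong\mathsf{Z}(\mathsf{F}(A))$. Condition (S): for every $T\in\mathcal{T}$, with $\eta_T\colon T\to Z$, $Z=\mathsf{F}(T)\in\mathcal{Z}$, and every arrow $Z'\to Z$ with $Z'\in\mathcal{Z}$, the pullback $\chi\colon T'\to Z'$ of $\eta_T$ along $Z'\to Z$ satisfies $T'\in\mathcal{T}$ and $\chi=\eta_{T'}$ (up to isomorphism). Condition (P): the reflector $\mathsf{F}$ is $\mathcal{Z}$-protoadditive, i.e. it preserves pullbacks of split epimorphisms along arrows inverted by $\mathsf{Z}$. Relative to the Galois structure $\Gamma$ (with respect to all arrows): a trivial extension is an arrow $f\colon A\to B$ whose naturality square $\eta_B f=\mathsf{F}(f)\eta_A$ is a pullback; an effective descent morphism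 is an arrow $h\colon A\to B$ whose change-of-base functor $h^*\colon\mathcal{C}/B\to\mathcal{C}/A$ is monadic; a normal extension is an effective descent morphism whose kernel pair projections are trivial extensions; a central extension is an arrow $f$ for which there is an effective descent morphism $g$ such that the pullback $g^*(f)$ of $f$ along $g$ is a trivial extension. *)

theory Defs
  imports Main
begin

section \<open>Categories, functors, adjunctions\<close>

text \<open>Composition is only meaningful on composable pairs of arrows, so every notion below is
  relativised to the carriers \<open>obj C\<close> and \<open>arr C\<close>.\<close>

record ('o, 'm) cat =
  obj :: "'o set"
  arr :: "'m set"
  src :: "'m \<Rightarrow> 'o"
  tgt :: "'m \<Rightarrow> 'o"
  idn :: "'o \<Rightarrow> 'm"
  cmp :: "'m \<Rightarrow> 'm \<Rightarrow> 'm"  (infixr "\<cdot>\<index>" 70)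

definition hom :: "('o, 'm) cat \<Rightarrow> 'o \<Rightarrow> 'o \<Rightarrow> 'm set" where
  "hom C A B = {f \<in> arr C. src C f = A \<and> tgt C f = B}"

locale category =
  fixes C :: "('o, 'm) cat" (structure)
  assumes src_obj: "f \<in> arr C \<Longrightarrow> src C f \<in> obj C"
    and tgt_obj: "f \<in> arr C \<Longrightarrow> tgt C f \<in> obj C"
    and idn_hom: "A \<in> obj C \<Longrightarrow> idn C A \<in> hom C A A"
    and cmp_hom: "f \<in> hom C A B \<Longrightarrow> g \<in> hom C B D \<Longrightarrow> g \<cdot> f \<in> hom C A D"
    and cmp_idn: "f \<in> arr C \<Longrightarrow> f \<cdot> idn C (src C f) = f"
    and idn_cmp: "f \<in> arr C \<Longrightarrow> idn C (tgt C f) \<cdot> f = f"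
    and cmp_assoc: "f \<in> hom C A B \<Longrightarrow> g \<in> hom C B D \<Longrightarrow> h \<in> hom C D E
      \<Longrightarrow> (h \<cdot> g) \<cdot> f = h \<cdot> (g \<cdot> f)"

definition full_sub :: "('o, 'm) cat \<Rightarrow> 'o set \<Rightarrow> ('o, 'm) cat" where
  "full_sub C S = C\<lparr>obj := obj C \<inter> S, arr := {f \<in> arr C. src C f \<in> S \<and> tgt C f \<in> S}\<rparr>"

record ('o, 'm, 'p, 'n) func =
  onObj :: "'o \<Rightarrow> 'p"
  onArr :: "'m \<Rightarrow> 'n"

definition is_functor :: "('o, 'm) cat \<Rightarrow> ('p, 'n) cat \<Rightarrow> ('o, 'm, 'p, 'n) func \<Rightarrow> bool" where
  "is_functor C D F \<longleftrightarrow> category C \<and> category D \<and>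
     (\<forall>A\<in>obj C. onObj F A \<in> obj D) \<and>
     (\<forall>f\<in>arr C. onArr F f \<in> hom D (onObj F (src C f)) (onObj F (tgt C f))) \<and>
     (\<forall>A\<in>obj C. onArr F (idn C A) = idn D (onObj F A)) \<and>
     (\<forall>f\<in>arr C. \<forall>g\<in>arr C. tgt C f = src C g \<longrightarrow>
        onArr F (g \<cdot>\<^bsub>C\<^esub> f) = onArr F g \<cdot>\<^bsub>D\<^esub> onArr F f)"

definition id_func :: "('o, 'm, 'o, 'm) func" where
  "id_func = \<lparr>onObj = (\<lambda>A. A), onArr = (\<lambda>f. f)\<rparr>"

definition comp_func ::
  "('p, 'n, 'q, 'k) func \<Rightarrow> ('o, 'm, 'p, 'n) func \<Rightarrow> ('o, 'm, 'q, 'k) func" where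
  "comp_func G F = \<lparr>onObj = (\<lambda>A. onObj G (onObj F A)), onArr = (\<lambda>f. onArr G (onArr F f))\<rparr>"

definition nat_trans :: "('o, 'm) cat \<Rightarrow> ('p, 'n) cat \<Rightarrow>
  ('o, 'm, 'p, 'n) func \<Rightarrow> ('o, 'm, 'p, 'n) func \<Rightarrow> ('o \<Rightarrow> 'n) \<Rightarrow> bool" where
  "nat_trans C D F G \<tau> \<longleftrightarrow> is_functor C D F \<and> is_functor C D G \<and>
     (\<forall>A\<in>obj C. \<tau> A \<in> hom D (onObj F A) (onObj G A)) \<and>
     (\<forall>f\<in>arr C. onArr G f \<cdot>\<^bsub>D\<^esub> \<tau> (src C f) = \<tau> (tgt C f) \<cdot>\<^bsub>D\<^esub> onArr F f)"

definition is_iso :: "('o, 'm) cat \<Rightarrow> 'm \<Rightarrow> bool" where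
  "is_iso C f \<longleftrightarrow> f \<in> arr C \<and> (\<exists>g\<in>hom C (tgt C f) (src C f).
     g \<cdot>\<^bsub>C\<^esub> f = idn C (src C f) \<and> f \<cdot>\<^bsub>C\<^esub> g = idn C (tgt C f))"

definition iso_objs :: "('o, 'm) cat \<Rightarrow> 'o \<Rightarrow> 'o \<Rightarrow> bool" where
  "iso_objs C A B \<longleftrightarrow> (\<exists>f\<in>hom C A B. is_iso C f)"

definition nat_iso :: "('o, 'm) cat \<Rightarrow> ('p, 'n) cat \<Rightarrow>
  ('o, 'm, 'p, 'n) func \<Rightarrow> ('o, 'm, 'p, 'n) func \<Rightarrow> ('o \<Rightarrow> 'n) \<Rightarrow> bool" where
  "nat_iso C D F G \<tau> \<longleftrightarrow> nat_trans C D F G \<tau> \<and> (\<forall>A\<in>obj C. is_iso D (\<tau> A))"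

definition is_equivalence :: "('o, 'm) cat \<Rightarrow> ('p, 'n) cat \<Rightarrow> ('o, 'm, 'p, 'n) func \<Rightarrow> bool" where
  "is_equivalence C D F \<longleftrightarrow> is_functor C D F \<and>
     (\<exists>G \<alpha> \<beta>. is_functor D C G \<and>
        nat_iso C C id_func (comp_func G F) \<alpha> \<and> nat_iso D D (comp_func F G) id_func \<beta>)"

text \<open>\<open>L : C \<rightarrow> D\<close> is left adjoint to \<open>R : D \<rightarrow> C\<close>, with unit \<open>\<eta>\<close> and counit \<open>\<epsilon>\<close>.\<close>

definition adjunction :: "('o, 'm) cat \<Rightarrow> ('p, 'n) cat \<Rightarrow>
  ('o, 'm, 'p, 'n) func \<Rightarrow> ('p, 'n, 'o, 'm) func \<Rightarrow> ('o \<Rightarrow> 'm) \<Rightarrow> ('p \<Rightarrow> 'n) \<Rightarrow> bool" where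
  "adjunction C D L R \<eta> \<epsilon> \<longleftrightarrow> is_functor C D L \<and> is_functor D C R \<and>
     nat_trans C C id_func (comp_func R L) \<eta> \<and> nat_trans D D (comp_func L R) id_func \<epsilon> \<and>
     (\<forall>A\<in>obj C. \<epsilon> (onObj L A) \<cdot>\<^bsub>D\<^esub> onArr L (\<eta> A) = idn D (onObj L A)) \<and>
     (\<forall>B\<in>obj D. onArr R (\<epsilon> B) \<cdot>\<^bsub>C\<^esub> \<eta> (onObj R B) = idn C (onObj R B))"


section \<open>Monadic functors\<close>

text \<open>Eilenberg--Moore category of the monad \<open>(T, \<eta>, \<mu>)\<close>. Since arrows must determine their
  source and target, a morphism of algebras is stored together with both algebras.\<close>

definition EM_objs ::
  "('o, 'm) cat \<Rightarrow> ('o, 'm, 'o, 'm) func \<Rightarrow> ('o \<Rightarrow> 'm) \<Rightarrow> ('o \<Rightarrow> 'm) \<Rightarrow> ('o \<times> 'm) set" where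
  "EM_objs C T \<eta> \<mu> = {(A, a). A \<in> obj C \<and> a \<in> hom C (onObj T A) A \<and>
     a \<cdot>\<^bsub>C\<^esub> \<eta> A = idn C A \<and> a \<cdot>\<^bsub>C\<^esub> \<mu> A = a \<cdot>\<^bsub>C\<^esub> onArr T a}"

definition EM :: "('o, 'm) cat \<Rightarrow> ('o, 'm, 'o, 'm) func \<Rightarrow> ('o \<Rightarrow> 'm) \<Rightarrow> ('o \<Rightarrow> 'm) \<Rightarrow>
  ('o \<times> 'm, ('o \<times> 'm) \<times> 'm \<times> ('o \<times> 'm)) cat" where
  "EM C T \<eta> \<mu> = \<lparr>
     obj = EM_objs C T \<eta> \<mu>,
     arr = {(X, h, Y). X \<in> EM_objs C T \<eta> \<mu> \<and> Y \<in> EM_objs C T \<eta> \<mu> \<and>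
              h \<in> hom C (fst X) (fst Y) \<and> h \<cdot>\<^bsub>C\<^esub> snd X = snd Y \<cdot>\<^bsub>C\<^esub> onArr T h},
     src = (\<lambda>(X, h, Y). X),
     tgt = (\<lambda>(X, h, Y). Y),
     idn = (\<lambda>X. (X, idn C (fst X), X)),
     cmp = (\<lambda>(Y', k, Z) (X, h, Y). (X, k \<cdot>\<^bsub>C\<^esub> h, Z))\<rparr>"

definition comparison :: "('p, 'n) cat \<Rightarrow> ('p, 'n, 'o, 'm) func \<Rightarrow> ('p \<Rightarrow> 'n) \<Rightarrow>
  ('p, 'n, 'o \<times> 'm, ('o \<times> 'm) \<times> 'm \<times> ('o \<times> 'm)) func" where
  "comparison D R \<epsilon> = \<lparr>
     onObj = (\<lambda>B. (onObj R B, onArr R (\<epsilon> B))),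
     onArr = (\<lambda>f. ((onObj R (src D f), onArr R (\<epsilon> (src D f))), onArr R f,
                    (onObj R (tgt D f), onArr R (\<epsilon> (tgt D f)))))\<rparr>"

definition monadic :: "('p, 'n) cat \<Rightarrow> ('o, 'm) cat \<Rightarrow> ('p, 'n, 'o, 'm) func \<Rightarrow> bool" where
  "monadic D C R \<longleftrightarrow> (\<exists>L \<eta> \<epsilon>. adjunction C D L R \<eta> \<epsilon> \<and>
     is_equivalence D (EM C (comp_func R L) \<eta> (\<lambda>A. onArr R (\<epsilon> (onObj L A)))) (comparison D R \<epsilon>))"


section \<open>Limits, monomorphisms and epimorphisms\<close>

definition is_mono :: "('o, 'm) cat \<Rightarrow> 'm \<Rightarrow> bool" where
  "is_mono C m \<longleftrightarrow> m \<in> arr C \<and> (\<forall>u\<in>arr C. \<forall>v\<in>arr C.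
     src C u = src C v \<and> tgt C u = src C m \<and> tgt C v = src C m \<and>
     m \<cdot>\<^bsub>C\<^esub> u = m \<cdot>\<^bsub>C\<^esub> v \<longrightarrow> u = v)"

definition is_split_epi :: "('o, 'm) cat \<Rightarrow> 'm \<Rightarrow> 'm \<Rightarrow> bool" where
  "is_split_epi C p s \<longleftrightarrow> p \<in> arr C \<and> s \<in> hom C (tgt C p) (src C p) \<and>
     p \<cdot>\<^bsub>C\<^esub> s = idn C (tgt C p)"

text \<open>The square \<open>f \<cdot> p = g \<cdot> q\<close> is a pullback; \<open>p\<close> is the pullback of \<open>g\<close> along \<open>f\<close>.\<close>

definition is_pullback :: "('o, 'm) cat \<Rightarrow> 'm \<Rightarrow> 'm \<Rightarrow> 'm \<Rightarrow> 'm \<Rightarrow> bool" where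
  "is_pullback C f g p q \<longleftrightarrow> f \<in> arr C \<and> g \<in> arr C \<and> tgt C f = tgt C g \<and>
     p \<in> arr C \<and> q \<in> arr C \<and> src C p = src C q \<and> tgt C p = src C f \<and> tgt C q = src C g \<and>
     f \<cdot>\<^bsub>C\<^esub> p = g \<cdot>\<^bsub>C\<^esub> q \<and>
     (\<forall>u\<in>arr C. \<forall>v\<in>arr C.
        src C u = src C v \<and> tgt C u = src C f \<and> tgt C v = src C g \<and>
        f \<cdot>\<^bsub>C\<^esub> u = g \<cdot>\<^bsub>C\<^esub> v \<longrightarrow>
        (\<exists>!w. w \<in> hom C (src C u) (src C p) \<and> p \<cdot>\<^bsub>C\<^esub> w = u \<and> q \<cdot>\<^bsub>C\<^esub> w = v))"

text \<open>A chosen pullback of \<open>f\<close> and \<open>g\<close>, where one exists: \<open>pb1 C f g\<close> is the projection to the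
  source of \<open>f\<close>, i.e. the pullback \<open>f\<^sup>*(g)\<close>, and \<open>pb2 C f g\<close> the one to the source of \<open>g\<close>.\<close>

definition pb :: "('o, 'm) cat \<Rightarrow> 'm \<Rightarrow> 'm \<Rightarrow> 'm \<times> 'm" where
  "pb C f g = (SOME (p, q). is_pullback C f g p q)"

definition pb1 :: "('o, 'm) cat \<Rightarrow> 'm \<Rightarrow> 'm \<Rightarrow> 'm" where
  "pb1 C f g = fst (pb C f g)"

definition pb2 :: "('o, 'm) cat \<Rightarrow> 'm \<Rightarrow> 'm \<Rightarrow> 'm" where
  "pb2 C f g = snd (pb C f g)"

definition has_pullbacks :: "('o, 'm) cat \<Rightarrow> bool" where
  "has_pullbacks C \<longleftrightarrow> (\<forall>f\<in>arr C. \<forall>g\<in>arr C. tgt C f = tgt C g \<longrightarrow> (\<exists>p q. is_pullback C f g p q))"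

definition has_terminal :: "('o, 'm) cat \<Rightarrow> bool" where
  "has_terminal C \<longleftrightarrow> (\<exists>X\<in>obj C. \<forall>A\<in>obj C. \<exists>!f. f \<in> hom C A X)"

text \<open>Finite limits, generated as usual by a terminal object and pullbacks.\<close>

definition finitely_complete :: "('o, 'm) cat \<Rightarrow> bool" where
  "finitely_complete C \<longleftrightarrow> category C \<and> has_terminal C \<and> has_pullbacks C"

definition is_coequalizer :: "('o, 'm) cat \<Rightarrow> 'm \<Rightarrow> 'm \<Rightarrow> 'm \<Rightarrow> bool" where
  "is_coequalizer C u v e \<longleftrightarrow> u \<in> arr C \<and> v \<in> arr C \<and> src C u = src C v \<and> tgt C u = tgt C v \<and>
     e \<in> arr C \<and> src C e = tgt C u \<and> e \<cdot>\<^bsub>C\<^esub> u = e \<cdot>\<^bsub>C\<^esub> v \<and>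
     (\<forall>h\<in>arr C. src C h = tgt C u \<and> h \<cdot>\<^bsub>C\<^esub> u = h \<cdot>\<^bsub>C\<^esub> v \<longrightarrow>
        (\<exists>!w. w \<in> hom C (tgt C e) (tgt C h) \<and> w \<cdot>\<^bsub>C\<^esub> e = h))"

definition is_regular_epi :: "('o, 'm) cat \<Rightarrow> 'm \<Rightarrow> bool" where
  "is_regular_epi C e \<longleftrightarrow> (\<exists>u v. is_coequalizer C u v e)"

definition jointly_extremally_epic :: "('o, 'm) cat \<Rightarrow> 'm \<Rightarrow> 'm \<Rightarrow> bool" where
  "jointly_extremally_epic C g s \<longleftrightarrow> g \<in> arr C \<and> s \<in> arr C \<and> tgt C g = tgt C s \<and>
     (\<forall>m. is_mono C m \<and> tgt C m = tgt C g \<and>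
        (\<exists>g'\<in>hom C (src C g) (src C m). m \<cdot>\<^bsub>C\<^esub> g' = g) \<and>
        (\<exists>s'\<in>hom C (src C s) (src C m). m \<cdot>\<^bsub>C\<^esub> s' = s) \<longrightarrow> is_iso C m)"


section \<open>Barr-exact and protomodular categories\<close>

definition regular_category :: "('o, 'm) cat \<Rightarrow> bool" where
  "regular_category C \<longleftrightarrow> finitely_complete C \<and>
     (\<forall>f u v. is_pullback C f f u v \<longrightarrow> (\<exists>e. is_coequalizer C u v e)) \<and>
     (\<forall>f g p q. is_pullback C f g p q \<and> is_regular_epi C g \<longrightarrow> is_regular_epi C p)"

definition is_equivalence_relation :: "('o, 'm) cat \<Rightarrow> 'm \<Rightarrow> 'm \<Rightarrow> bool" where
  "is_equivalence_relation C r1 r2 \<longleftrightarrow> r1 \<in> arr C \<and> r2 \<in> arr C \<and>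
     src C r1 = src C r2 \<and> tgt C r1 = tgt C r2 \<and>
     \<comment> \<open>jointly monic\<close>
     (\<forall>u\<in>arr C. \<forall>v\<in>arr C. src C u = src C v \<and> tgt C u = src C r1 \<and> tgt C v = src C r1 \<and>
        r1 \<cdot>\<^bsub>C\<^esub> u = r1 \<cdot>\<^bsub>C\<^esub> v \<and> r2 \<cdot>\<^bsub>C\<^esub> u = r2 \<cdot>\<^bsub>C\<^esub> v \<longrightarrow> u = v) \<and>
     \<comment> \<open>reflexive\<close>
     (\<exists>d\<in>hom C (tgt C r1) (src C r1).
        r1 \<cdot>\<^bsub>C\<^esub> d = idn C (tgt C r1) \<and> r2 \<cdot>\<^bsub>C\<^esub> d = idn C (tgt C r1)) \<and>
     \<comment> \<open>symmetric\<close>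
     (\<exists>s\<in>hom C (src C r1) (src C r1). r1 \<cdot>\<^bsub>C\<^esub> s = r2 \<and> r2 \<cdot>\<^bsub>C\<^esub> s = r1) \<and>
     \<comment> \<open>transitive\<close>
     (\<forall>p q. is_pullback C r2 r1 p q \<longrightarrow>
        (\<exists>t\<in>hom C (src C p) (src C r1).
           r1 \<cdot>\<^bsub>C\<^esub> t = r1 \<cdot>\<^bsub>C\<^esub> p \<and> r2 \<cdot>\<^bsub>C\<^esub> t = r2 \<cdot>\<^bsub>C\<^esub> q))"

definition barr_exact :: "('o, 'm) cat \<Rightarrow> bool" where
  "barr_exact C \<longleftrightarrow> regular_category C \<and>
     (\<forall>r1 r2. is_equivalence_relation C r1 r2 \<longrightarrow> (\<exists>f. is_pullback C f f r1 r2))"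

definition protomodular :: "('o, 'm) cat \<Rightarrow> bool" where
  "protomodular C \<longleftrightarrow> category C \<and>
     (\<forall>p s f. is_split_epi C p s \<and> f \<in> arr C \<and> tgt C f = tgt C p \<longrightarrow>
        (\<exists>q g. is_pullback C f p q g) \<and>
        (\<forall>q g. is_pullback C f p q g \<longrightarrow> jointly_extremally_epic C g s))"


section \<open>Effective descent morphisms\<close>

text \<open>The slice over \<open>B\<close>: an arrow from \<open>f\<close> to \<open>g\<close> is stored as \<open>(f, u, g)\<close> with
  \<open>g \<cdot> u = f\<close>.\<close>

definition slice :: "('o, 'm) cat \<Rightarrow> 'o \<Rightarrow> ('m, 'm \<times> 'm \<times> 'm) cat" where
  "slice C B = \<lparr>
     obj = {f \<in> arr C. tgt C f = B},
     arr = {(f, u, g). f \<in> arr C \<and> tgt C f = B \<and> g \<in> arr C \<and> tgt C g = B \<and>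
              u \<in> hom C (src C f) (src C g) \<and> g \<cdot>\<^bsub>C\<^esub> u = f},
     src = (\<lambda>(f, u, g). f),
     tgt = (\<lambda>(f, u, g). g),
     idn = (\<lambda>f. (f, idn C (src C f), f)),
     cmp = (\<lambda>(g', v, h) (f, u, g). (f, v \<cdot>\<^bsub>C\<^esub> u, h))\<rparr>"

definition change_of_base ::
  "('o, 'm) cat \<Rightarrow> 'm \<Rightarrow> ('m, 'm \<times> 'm \<times> 'm, 'm, 'm \<times> 'm \<times> 'm) func" where
  "change_of_base C h = \<lparr>
     onObj = (\<lambda>f. pb1 C h f),
     onArr = (\<lambda>(f, u, g). (pb1 C h f,
        THE v. v \<in> hom C (src C (pb1 C h f)) (src C (pb1 C h g)) \<and>
               pb1 C h g \<cdot>\<^bsub>C\<^esub> v = pb1 C h f \<and>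
               pb2 C h g \<cdot>\<^bsub>C\<^esub> v = u \<cdot>\<^bsub>C\<^esub> pb2 C h f,
        pb1 C h g))\<rparr>"

definition effective_descent :: "('o, 'm) cat \<Rightarrow> 'm \<Rightarrow> bool" where
  "effective_descent C h \<longleftrightarrow> h \<in> arr C \<and>
     monadic (slice C (tgt C h)) (slice C (src C h)) (change_of_base C h)"


section \<open>Classes of zero objects and torsion theories\<close>

definition replete :: "('o, 'm) cat \<Rightarrow> 'o set \<Rightarrow> bool" where
  "replete C S \<longleftrightarrow> S \<subseteq> obj C \<and> (\<forall>A\<in>S. \<forall>B\<in>obj C. iso_objs C A B \<longrightarrow> B \<in> S)"

text \<open>\<open>\<Z>\<close> is a class of zero objects, with coreflector \<open>Zr\<close> and counit \<open>\<epsilon>\<close>.\<close>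

definition class_of_zero_objects ::
  "('o, 'm) cat \<Rightarrow> 'o set \<Rightarrow> ('o, 'm, 'o, 'm) func \<Rightarrow> ('o \<Rightarrow> 'm) \<Rightarrow> bool" where
  "class_of_zero_objects C \<Z> Zr \<epsilon> \<longleftrightarrow> category C \<and> replete C \<Z> \<and>
     (\<forall>A\<in>\<Z>. \<forall>B\<in>\<Z>. \<forall>f\<in>hom C A B. \<forall>g\<in>hom C A B. f = g) \<and>
     (\<exists>\<eta>. adjunction (full_sub C \<Z>) C id_func Zr \<eta> \<epsilon>) \<and>
     (\<forall>A\<in>obj C. is_mono C (\<epsilon> A)) \<and>
     (\<forall>m. is_mono C m \<longrightarrow> is_iso C (onArr Zr m))"

definition null_arrows :: "('o, 'm) cat \<Rightarrow> 'o set \<Rightarrow> 'm set" where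
  "null_arrows C \<Z> = {f \<in> arr C. \<exists>W\<in>\<Z>. \<exists>u\<in>hom C (src C f) W. \<exists>v\<in>hom C W (tgt C f).
     f = v \<cdot>\<^bsub>C\<^esub> u}"

definition is_zkernel :: "('o, 'm) cat \<Rightarrow> 'o set \<Rightarrow> 'm \<Rightarrow> 'm \<Rightarrow> bool" where
  "is_zkernel C \<Z> f k \<longleftrightarrow> f \<in> arr C \<and> k \<in> arr C \<and> tgt C k = src C f \<and>
     f \<cdot>\<^bsub>C\<^esub> k \<in> null_arrows C \<Z> \<and>
     (\<forall>e\<in>arr C. tgt C e = src C f \<and> f \<cdot>\<^bsub>C\<^esub> e \<in> null_arrows C \<Z> \<longrightarrow>
        (\<exists>!u. u \<in> hom C (src C e) (src C k) \<and> k \<cdot>\<^bsub>C\<^esub> u = e))"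

definition is_zcokernel :: "('o, 'm) cat \<Rightarrow> 'o set \<Rightarrow> 'm \<Rightarrow> 'm \<Rightarrow> bool" where
  "is_zcokernel C \<Z> f c \<longleftrightarrow> f \<in> arr C \<and> c \<in> arr C \<and> src C c = tgt C f \<and>
     c \<cdot>\<^bsub>C\<^esub> f \<in> null_arrows C \<Z> \<and>
     (\<forall>e\<in>arr C. src C e = tgt C f \<and> e \<cdot>\<^bsub>C\<^esub> f \<in> null_arrows C \<Z> \<longrightarrow>
        (\<exists>!u. u \<in> hom C (tgt C c) (tgt C e) \<and> u \<cdot>\<^bsub>C\<^esub> c = e))"

definition short_zexact :: "('o, 'm) cat \<Rightarrow> 'o set \<Rightarrow> 'm \<Rightarrow> 'm \<Rightarrow> bool" where
  "short_zexact C \<Z> f g \<longleftrightarrow> is_zkernel C \<Z> g f \<and> is_zcokernel C \<Z> f g"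

text \<open>\<open>K[f]\<close>, well defined up to isomorphism.\<close>

definition zker_obj :: "('o, 'm) cat \<Rightarrow> 'o set \<Rightarrow> 'm \<Rightarrow> 'o" where
  "zker_obj C \<Z> f = src C (SOME k. is_zkernel C \<Z> f k)"

text \<open>A torsion theory together with a choice of the short exact sequences
  \<open>src C (t A) \<rightarrow> A \<rightarrow> tgt C (\<eta> A)\<close>; thus \<open>\<T>(A) = src C (t A)\<close> and \<open>\<F>(A) = tgt C (\<eta> A)\<close>.\<close>

definition torsion_theory :: "('o, 'm) cat \<Rightarrow> 'o set \<Rightarrow> 'o set \<Rightarrow> 'o set \<Rightarrow>
  ('o \<Rightarrow> 'm) \<Rightarrow> ('o \<Rightarrow> 'm) \<Rightarrow> bool" where
  "torsion_theory C \<Z> \<T> \<F> t \<eta> \<longleftrightarrow> category C \<and> replete C \<T> \<and> replete C \<F> \<and> \<T> \<inter> \<F> = \<Z> \<and>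
     (\<forall>X\<in>\<T>. \<forall>Y\<in>\<F>. hom C X Y \<subseteq> null_arrows C \<Z>) \<and>
     (\<forall>A\<in>obj C. tgt C (t A) = A \<and> src C (\<eta> A) = A \<and> src C (t A) \<in> \<T> \<and> tgt C (\<eta> A) \<in> \<F> \<and>
        short_zexact C \<Z> (t A) (\<eta> A))"

text \<open>The reflector \<open>\<F>\<close>, determined on arrows by naturality of \<open>\<eta>\<close>.\<close>

definition reflector :: "('o, 'm) cat \<Rightarrow> ('o \<Rightarrow> 'm) \<Rightarrow> ('o, 'm, 'o, 'm) func" where
  "reflector C \<eta> = \<lparr>
     onObj = (\<lambda>A. tgt C (\<eta> A)),
     onArr = (\<lambda>f. THE g. g \<in> hom C (tgt C (\<eta> (src C f))) (tgt C (\<eta> (tgt C f))) \<and>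
                         g \<cdot>\<^bsub>C\<^esub> \<eta> (src C f) = \<eta> (tgt C f) \<cdot>\<^bsub>C\<^esub> f)\<rparr>"

definition condition_M' ::
  "('o, 'm) cat \<Rightarrow> ('o, 'm, 'o, 'm) func \<Rightarrow> ('o \<Rightarrow> 'm) \<Rightarrow> ('o \<Rightarrow> 'm) \<Rightarrow> bool" where
  "condition_M' C Zr t \<eta> \<longleftrightarrow> (\<forall>A\<in>obj C.
     iso_objs C (onObj (reflector C \<eta>) (src C (t A))) (onObj Zr (onObj (reflector C \<eta>) A)))"

definition condition_S ::
  "('o, 'm) cat \<Rightarrow> 'o set \<Rightarrow> 'o set \<Rightarrow> ('o \<Rightarrow> 'm) \<Rightarrow> bool" where
  "condition_S C \<Z> \<T> \<eta> \<longleftrightarrow> (\<forall>X\<in>\<T>. \<forall>z\<in>arr C. src C z \<in> \<Z> \<and> tgt C z = tgt C (\<eta> X) \<longrightarrow>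
     (\<forall>\<chi> q. is_pullback C z (\<eta> X) \<chi> q \<longrightarrow>
        src C \<chi> \<in> \<T> \<and>
        (\<exists>i\<in>hom C (tgt C (\<eta> (src C \<chi>))) (tgt C \<chi>). is_iso C i \<and> i \<cdot>\<^bsub>C\<^esub> \<eta> (src C \<chi>) = \<chi>)))"

definition condition_P :: "('o, 'm) cat \<Rightarrow> ('o, 'm, 'o, 'm) func \<Rightarrow> 'o set \<Rightarrow> ('o \<Rightarrow> 'm) \<Rightarrow> bool" where
  "condition_P C Zr \<F> \<eta> \<longleftrightarrow> (\<forall>f p s q g.
     is_split_epi C p s \<and> is_pullback C f p q g \<and> is_iso C (onArr Zr f) \<longrightarrow>
     is_pullback (full_sub C \<F>)
       (onArr (reflector C \<eta>) f) (onArr (reflector C \<eta>) p)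
       (onArr (reflector C \<eta>) q) (onArr (reflector C \<eta>) g))"


section \<open>Extensions relative to a Galois structure\<close>

text \<open>For an adjunction with left adjoint \<open>I : C \<rightarrow> X\<close>, right adjoint \<open>H : X \<rightarrow> C\<close> and unit \<open>\<eta>\<close>,
  taken with respect to the classes of all arrows of \<open>C\<close> and of \<open>X\<close>.\<close>

definition trivial_extension :: "('o, 'm) cat \<Rightarrow> ('o, 'm, 'p, 'n) func \<Rightarrow> ('p, 'n, 'o, 'm) func \<Rightarrow>
  ('o \<Rightarrow> 'm) \<Rightarrow> 'm \<Rightarrow> bool" where
  "trivial_extension C I H \<eta> f \<longleftrightarrow> f \<in> arr C \<and>
     is_pullback C (\<eta> (tgt C f)) (onArr H (onArr I f)) f (\<eta> (src C f))"

definition normal_extension :: "('o, 'm) cat \<Rightarrow> ('o, 'm, 'p, 'n) func \<Rightarrow> ('p, 'n, 'o, 'm) func \<Rightarrow>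
  ('o \<Rightarrow> 'm) \<Rightarrow> 'm \<Rightarrow> bool" where
  "normal_extension C I H \<eta> f \<longleftrightarrow> effective_descent C f \<and>
     trivial_extension C I H \<eta> (pb1 C f f) \<and> trivial_extension C I H \<eta> (pb2 C f f)"

definition central_extension :: "('o, 'm) cat \<Rightarrow> ('o, 'm, 'p, 'n) func \<Rightarrow> ('p, 'n, 'o, 'm) func \<Rightarrow>
  ('o \<Rightarrow> 'm) \<Rightarrow> 'm \<Rightarrow> bool" where
  "central_extension C I H \<eta> f \<longleftrightarrow> f \<in> arr C \<and>
     (\<exists>g. effective_descent C g \<and> tgt C g = tgt C f \<and> trivial_extension C I H \<eta> (pb1 C g f))"

end

theory Submission
  imports Defs
begin

text \<open>Every arrow into a zero object is a regular epimorphism, since its image is a subobject of a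
  zero object and those are trivial. If \<open>f\<close> becomes a trivial extension after pulling back along \<open>g\<close>,
  condition (S) lets one pull the torsion part of \<open>K[f]\<close> back along \<open>\<Z>(g)\<close> without leaving the torsion
  class; triviality makes the result factor through a zero object, so the torsion part of \<open>K[f]\<close> is
  null and \<open>K[f]\<close> is torsion-free. Conversely, if \<open>K[f]\<close> is torsion-free, then so is the pullback of a
  kernel pair projection \<open>p\<close> of \<open>f\<close> along the counit \<open>\<Z>(A) \<rightarrow> A\<close>. By condition (P) the comparison from
  \<open>p\<close> to the pullback of \<open>F(p)\<close> along the unit is invertible over \<open>\<Z>(A)\<close>, and in a protomodular
  category pulling back split epimorphisms reflects isomorphisms.\<close>

section \<open>Pullbacks and regular epimorphisms\<close>

context category
begin

section \<open>Arrows and their composition\<close>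

lemma homD:
  assumes "f \<in> hom C A B"
  shows "f \<in> arr C" "src C f = A" "tgt C f = B"
  using assms by (auto simp: hom_def)

lemma arr_cmp [simp]:
  assumes "f \<in> arr C" "g \<in> arr C" "tgt C f = src C g"
  shows "g \<cdot> f \<in> arr C" "src C (g \<cdot> f) = src C f" "tgt C (g \<cdot> f) = tgt C g"
  using cmp_hom[of f "src C f" "src C g" g "tgt C g"] assms by (auto simp: hom_def)

text \<open>Oriented so that simplification nests all composites to the right, the normal form used
  throughout.\<close>

lemma assoc [simp]:
  assumes "f \<in> arr C" "g \<in> arr C" "h \<in> arr C" "tgt C f = src C g" "tgt C g = src C h"
  shows "(h \<cdot> g) \<cdot> f = h \<cdot> (g \<cdot> f)"
  using cmp_assoc[of f "src C f" "src C g" g "src C h" h "tgt C h"] assms by (auto simp: hom_def)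

lemma arr_idn [simp]:
  assumes "A \<in> obj C"
  shows "idn C A \<in> arr C" "src C (idn C A) = A" "tgt C (idn C A) = A"
  using idn_hom[OF assms] by (auto simp: hom_def)

lemma idn_right [simp]: "f \<in> arr C \<Longrightarrow> src C f = A \<Longrightarrow> f \<cdot> idn C A = f"
  using cmp_idn by auto

lemma idn_left [simp]: "f \<in> arr C \<Longrightarrow> tgt C f = A \<Longrightarrow> idn C A \<cdot> f = f"
  using idn_cmp by auto

lemma obj_src_tgt [simp]: "f \<in> arr C \<Longrightarrow> src C f \<in> obj C" "f \<in> arr C \<Longrightarrow> tgt C f \<in> obj C"
  using src_obj tgt_obj by auto

text \<open>In right-nested form an equation between two-fold composites no longer matches once a
  further arrow \<open>x\<close> is applied first. This rule, and its variant for a single arrow on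
  the right-hand side, applies the equation in that position; most diagram chases below consist of
  such steps.\<close>

lemma cmp_cong_right:
  assumes "g \<cdot> f = g' \<cdot> f'" "x \<in> arr C" "f \<in> arr C" "g \<in> arr C" "f' \<in> arr C" "g' \<in> arr C"
    "tgt C x = src C f" "tgt C x = src C f'" "tgt C f = src C g" "tgt C f' = src C g'"
  shows "g \<cdot> (f \<cdot> x) = g' \<cdot> (f' \<cdot> x)"
  using assms assoc[of x f g] assoc[of x f' g'] by simp

lemma cmp_cong_right1:
  assumes "g \<cdot> f = h" "x \<in> arr C" "f \<in> arr C" "g \<in> arr C"
    "tgt C x = src C f" "tgt C f = src C g"
  shows "g \<cdot> (f \<cdot> x) = h \<cdot> x"
  using assms assoc[of x f g] by simp

section \<open>Monomorphisms and isomorphisms\<close>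

lemma monoD:
  assumes "is_mono C m" "u \<in> hom C X (src C m)" "v \<in> hom C X (src C m)" "m \<cdot> u = m \<cdot> v"
  shows "u = v"
  using assms unfolding is_mono_def by (auto simp: hom_def)

lemma split_mono:
  assumes m: "m \<in> hom C A B" and r: "r \<in> hom C B A" and rm: "r \<cdot> m = idn C A"
  shows "is_mono C m"
  unfolding is_mono_def
proof (intro conjI ballI impI)
  show "m \<in> arr C" using homD(1)[OF m] .
next
  fix u v
  assume uv: "u \<in> arr C" "v \<in> arr C"
    "src C u = src C v \<and> tgt C u = src C m \<and> tgt C v = src C m \<and> m \<cdot> u = m \<cdot> v"
  have cancel: "r \<cdot> (m \<cdot> x) = x" if "x \<in> arr C" "tgt C x = A" for x
    using that cmp_cong_right1[OF rm, of x] homD[OF m] homD[OF r] by simp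
  have "u = r \<cdot> (m \<cdot> u)" by (rule cancel[symmetric]) (use uv homD[OF m] in auto)
  also have "m \<cdot> u = m \<cdot> v" using uv by simp
  also have "r \<cdot> (m \<cdot> v) = v" using cancel uv homD[OF m] by simp
  finally show "u = v" .
qed

lemma isoE:
  assumes "is_iso C f"
  obtains g where "g \<in> hom C (tgt C f) (src C f)" "g \<cdot> f = idn C (src C f)" "f \<cdot> g = idn C (tgt C f)"
  using assms unfolding is_iso_def by blast

lemma isoI:
  assumes "f \<in> hom C A B" "g \<in> hom C B A" "g \<cdot> f = idn C A" "f \<cdot> g = idn C B"
  shows "is_iso C f"
  using assms unfolding is_iso_def by (auto simp: hom_def)

lemma iso_mono:
  assumes "is_iso C f"
  shows "is_mono C f"
proof -
  obtain g where "g \<in> hom C (tgt C f) (src C f)" "g \<cdot> f = idn C (src C f)"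
    using isoE[OF assms] by metis
  moreover have "f \<in> hom C (src C f) (tgt C f)" using assms by (simp add: is_iso_def hom_def)
  ultimately show ?thesis using split_mono by blast
qed

text \<open>From \<open>m (r m) = m\<close> one cancels the monomorphism \<open>m\<close> on the
  left.\<close>

lemma mono_split_epi_iso:
  assumes mono: "is_mono C m" and m: "m \<in> hom C A B" and r: "r \<in> hom C B A"
    and mr: "m \<cdot> r = idn C B"
  shows "is_iso C m"
proof (rule isoI[OF m r _ mr])
  note [simp] = homD[OF m] homD[OF r]
  show "r \<cdot> m = idn C A"
  proof (rule monoD[OF mono])
    show "m \<cdot> (r \<cdot> m) = m \<cdot> idn C A"
      using cmp_cong_right1[OF mr, of m] obj_src_tgt[of m] by simp
  qed (use obj_src_tgt[of m] in \<open>auto simp: hom_def\<close>)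
qed

section \<open>Pullback squares\<close>

text \<open>Existence and uniqueness of the mediating arrow are separate premises, since later they
  rest on different arguments.\<close>

lemma pullbackI:
  assumes "f \<in> hom C A D" "g \<in> hom C B D" "p \<in> hom C P A" "q \<in> hom C P B" "f \<cdot> p = g \<cdot> q"
    and "\<And>X u v. u \<in> hom C X A \<Longrightarrow> v \<in> hom C X B \<Longrightarrow> f \<cdot> u = g \<cdot> v
      \<Longrightarrow> \<exists>w\<in>hom C X P. p \<cdot> w = u \<and> q \<cdot> w = v"
    and "\<And>X w w'. w \<in> hom C X P \<Longrightarrow> w' \<in> hom C X P \<Longrightarrow> p \<cdot> w = p \<cdot> w' \<Longrightarrow> q \<cdot> w = q \<cdot> w' \<Longrightarrow> w = w'"
  shows "is_pullback C f g p q"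
  unfolding is_pullback_def
proof (intro conjI ballI impI)
  fix u v
  assume uv: "u \<in> arr C" "v \<in> arr C"
    "src C u = src C v \<and> tgt C u = src C f \<and> tgt C v = src C g \<and> f \<cdot> u = g \<cdot> v"
  then have "u \<in> hom C (src C u) A" "v \<in> hom C (src C u) B" "f \<cdot> u = g \<cdot> v" and P: "src C p = P"
    using assms(1-3) by (auto simp: hom_def)
  then show "\<exists>!w. w \<in> hom C (src C u) (src C p) \<and> p \<cdot> w = u \<and> q \<cdot> w = v"
    using assms(6)[of u "src C u" v] assms(7)[of _ "src C u"] unfolding P by metis
qed (use assms(1-5) in \<open>auto simp: hom_def\<close>)

lemma pullbackD:
  assumes "is_pullback C f g p q"
  shows "f \<in> hom C (src C f) (tgt C f)" "g \<in> hom C (src C g) (tgt C f)"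
    "p \<in> hom C (src C p) (src C f)" "q \<in> hom C (src C p) (src C g)" "f \<cdot> p = g \<cdot> q"
  using assms unfolding is_pullback_def hom_def by auto

lemma pullback_universal:
  assumes "is_pullback C f g p q" "u \<in> hom C X (src C f)" "v \<in> hom C X (src C g)" "f \<cdot> u = g \<cdot> v"
  shows "\<exists>!w. w \<in> hom C X (src C p) \<and> p \<cdot> w = u \<and> q \<cdot> w = v"
proof -
  have "\<forall>u\<in>arr C. \<forall>v\<in>arr C.
      src C u = src C v \<and> tgt C u = src C f \<and> tgt C v = src C g \<and> f \<cdot> u = g \<cdot> v \<longrightarrow>
      (\<exists>!w. w \<in> hom C (src C u) (src C p) \<and> p \<cdot> w = u \<and> q \<cdot> w = v)"
    using assms(1) unfolding is_pullback_def by (elim conjE)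
  from this[rule_format, OF homD(1)[OF assms(2)] homD(1)[OF assms(3)]] show ?thesis
    using assms(4) homD[OF assms(2)] homD[OF assms(3)] by simp
qed

lemma pullback_lift:
  assumes "is_pullback C f g p q" "u \<in> hom C X (src C f)" "v \<in> hom C X (src C g)" "f \<cdot> u = g \<cdot> v"
  obtains w where "w \<in> hom C X (src C p)" "p \<cdot> w = u" "q \<cdot> w = v"
  using pullback_universal[OF assms] by metis

lemma pullback_unique:
  assumes pb: "is_pullback C f g p q" and w: "w \<in> hom C X (src C p)" "w' \<in> hom C X (src C p)"
    and eq: "p \<cdot> w = p \<cdot> w'" "q \<cdot> w = q \<cdot> w'"
  shows "w = w'"
proof -
  note D = homD[OF pullbackD(1)[OF pb]] homD[OF pullbackD(2)[OF pb]]
    homD[OF pullbackD(3)[OF pb]] homD[OF pullbackD(4)[OF pb]] pullbackD(5)[OF pb]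
  note W = homD[OF w(1)] homD[OF w(2)]
  have "f \<cdot> (p \<cdot> w) = g \<cdot> (q \<cdot> w)"
    using D W by (intro cmp_cong_right) auto
  then have "\<exists>!x. x \<in> hom C X (src C p) \<and> p \<cdot> x = p \<cdot> w \<and> q \<cdot> x = q \<cdot> w"
    using D W by (intro pullback_universal[OF pb]) (simp_all add: hom_def)
  then show ?thesis using w eq by metis
qed

lemma pullback_sym:
  assumes pb: "is_pullback C f g p q"
  shows "is_pullback C g f q p"
proof (rule pullbackI)
  note D = pullbackD[OF pb]
  show "g \<in> hom C (src C g) (tgt C f)" "f \<in> hom C (src C f) (tgt C f)"
    "q \<in> hom C (src C p) (src C g)" "p \<in> hom C (src C p) (src C f)" "g \<cdot> q = f \<cdot> p"
    using D by auto
next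
  fix X u v assume uv: "u \<in> hom C X (src C g)" "v \<in> hom C X (src C f)" "g \<cdot> u = f \<cdot> v"
  obtain w where "w \<in> hom C X (src C p)" "p \<cdot> w = v" "q \<cdot> w = u"
    using pullback_lift[OF pb uv(2,1) uv(3)[symmetric]] .
  then show "\<exists>w\<in>hom C X (src C p). q \<cdot> w = u \<and> p \<cdot> w = v" by blast
next
  fix X w w' assume "w \<in> hom C X (src C p)" "w' \<in> hom C X (src C p)"
    "q \<cdot> w = q \<cdot> w'" "p \<cdot> w = p \<cdot> w'"
  then show "w = w'" using pullback_unique[OF pb] by blast
qed

lemma pb_is_pullback:
  assumes "has_pullbacks C" "f \<in> arr C" "g \<in> arr C" "tgt C f = tgt C g"
  shows "is_pullback C f g (pb1 C f g) (pb2 C f g)"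
proof -
  have "\<exists>x. (case x of (p, q) \<Rightarrow> is_pullback C f g p q)"
    using assms unfolding has_pullbacks_def by auto
  then have "case pb C f g of (p, q) \<Rightarrow> is_pullback C f g p q"
    unfolding pb_def by (rule someI_ex)
  then show ?thesis by (simp add: pb1_def pb2_def case_prod_beta)
qed

section \<open>Coequalizers, regular epimorphisms and images\<close>

lemma coequalizer_universal:
  assumes "is_coequalizer C u v e" "h \<in> hom C (tgt C u) X" "h \<cdot> u = h \<cdot> v"
  shows "\<exists>!w. w \<in> hom C (tgt C e) X \<and> w \<cdot> e = h"
proof -
  have "\<forall>h\<in>arr C. src C h = tgt C u \<and> h \<cdot> u = h \<cdot> v \<longrightarrow>
      (\<exists>!w. w \<in> hom C (tgt C e) (tgt C h) \<and> w \<cdot> e = h)"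
    using assms(1) unfolding is_coequalizer_def by (elim conjE)
  from this[rule_format, OF homD(1)[OF assms(2)]] show ?thesis
    using assms(3) homD[OF assms(2)] by simp
qed

lemma coequalizer_lift:
  assumes "is_coequalizer C u v e" "h \<in> hom C (tgt C u) X" "h \<cdot> u = h \<cdot> v"
  obtains w where "w \<in> hom C (tgt C e) X" "w \<cdot> e = h"
  using coequalizer_universal[OF assms] by metis

lemma coequalizer_epi:
  assumes ce: "is_coequalizer C u v e"
    and w: "w \<in> hom C (tgt C e) X" "w' \<in> hom C (tgt C e) X" "w \<cdot> e = w' \<cdot> e"
  shows "w = w'"
proof -
  have e: "u \<in> arr C" "v \<in> arr C" "src C u = src C v" "tgt C u = tgt C v" "e \<in> arr C"
    "src C e = tgt C u" "e \<cdot> u = e \<cdot> v"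
    using ce unfolding is_coequalizer_def by auto
  note W = homD[OF w(1)] homD[OF w(2)]
  have "w \<cdot> (e \<cdot> u) = w \<cdot> (e \<cdot> v)" using e by simp
  then have "w \<cdot> e \<in> arr C" "src C (w \<cdot> e) = tgt C u" "tgt C (w \<cdot> e) = X"
    "(w \<cdot> e) \<cdot> u = (w \<cdot> e) \<cdot> v"
    using e W by simp_all
  then have "\<exists>!x. x \<in> hom C (tgt C e) X \<and> x \<cdot> e = w \<cdot> e"
    by (intro coequalizer_universal[OF ce]) (simp_all add: hom_def)
  then show ?thesis using w by metis
qed

text \<open>As \<open>m\<close> is monic, \<open>h\<close> identifies the pair that \<open>e\<close>
  coequalizes, so it factors through \<open>e\<close>. The factor is the diagonal of the square
  because \<open>e\<close> is epic.\<close>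

lemma regular_epi_strong:
  assumes e: "is_regular_epi C e" and m: "is_mono C m"
    and h: "h \<in> hom C (src C e) (src C m)" and x: "x \<in> hom C (tgt C e) (tgt C m)"
    and sq: "x \<cdot> e = m \<cdot> h"
  obtains w where "w \<in> hom C (tgt C e) (src C m)" "m \<cdot> w = x"
proof -
  obtain u v where ce: "is_coequalizer C u v e" using e unfolding is_regular_epi_def by auto
  have E: "u \<in> arr C" "v \<in> arr C" "src C u = src C v" "tgt C u = tgt C v" "e \<in> arr C"
    "src C e = tgt C u" "e \<cdot> u = e \<cdot> v"
    using ce unfolding is_coequalizer_def by auto
  have M: "m \<in> arr C" using m unfolding is_mono_def by auto
  note H = homD[OF h] homD[OF x]
  have "m \<cdot> (h \<cdot> u) = x \<cdot> (e \<cdot> u)"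
    using sq E M H by (intro cmp_cong_right) auto
  also have "\<dots> = x \<cdot> (e \<cdot> v)" using E by simp
  also have "\<dots> = m \<cdot> (h \<cdot> v)"
    using sq E M H by (intro cmp_cong_right) auto
  finally have eq: "m \<cdot> (h \<cdot> u) = m \<cdot> (h \<cdot> v)" .
  have "h \<cdot> u = h \<cdot> v"
    by (rule monoD[OF m, of _ "src C u"])
      (use eq E M H in \<open>simp_all add: hom_def\<close>)
  then obtain w where w: "w \<in> hom C (tgt C e) (src C m)" "w \<cdot> e = h"
    using coequalizer_lift[OF ce] h E by metis
  have "m \<cdot> w = x"
    by (rule coequalizer_epi[OF ce, of _ "tgt C m"])
      (use sq w(2) M H E homD[OF w(1)] in \<open>simp_all add: hom_def\<close>)
  then show thesis using that w by blast
qed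

lemma regular_epi_epi:
  assumes "is_regular_epi C e" "w \<in> hom C (tgt C e) X" "w' \<in> hom C (tgt C e) X" "w \<cdot> e = w' \<cdot> e"
  shows "w = w'"
  using assms coequalizer_epi unfolding is_regular_epi_def by blast

lemma coequalizer_iso_comp:
  assumes ce: "is_coequalizer C u v e" and m: "is_iso C m" "src C m = tgt C e"
  shows "is_coequalizer C u v (m \<cdot> e)"
proof -
  have E: "u \<in> arr C" "v \<in> arr C" "src C u = src C v" "tgt C u = tgt C v" "e \<in> arr C"
    "src C e = tgt C u" "e \<cdot> u = e \<cdot> v"
    using ce unfolding is_coequalizer_def by auto
  obtain n where n: "n \<in> hom C (tgt C m) (src C m)" "n \<cdot> m = idn C (src C m)"
    "m \<cdot> n = idn C (tgt C m)"
    using isoE[OF m(1)] .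
  have M: "m \<in> arr C" using m unfolding is_iso_def by auto
  note N = homD[OF n(1)]
  show ?thesis
    unfolding is_coequalizer_def
  proof (intro conjI ballI impI)
    fix h assume h: "h \<in> arr C" "src C h = tgt C u \<and> h \<cdot> u = h \<cdot> v"
    then obtain w where w: "w \<in> hom C (tgt C e) (tgt C h)" "w \<cdot> e = h"
      using coequalizer_lift[OF ce, of h "tgt C h"] by (auto simp: hom_def)
    note W = homD[OF w(1)]
    show "\<exists>!w. w \<in> hom C (tgt C (m \<cdot> e)) (tgt C h) \<and> w \<cdot> (m \<cdot> e) = h"
    proof (rule ex1I[of _ "w \<cdot> n"])
      show "w \<cdot> n \<in> hom C (tgt C (m \<cdot> e)) (tgt C h) \<and> (w \<cdot> n) \<cdot> m \<cdot> e = h"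
        using M N W E w m cmp_cong_right1[OF n(2), of e] by (auto simp: hom_def)
    next
      fix w' assume w': "w' \<in> hom C (tgt C (m \<cdot> e)) (tgt C h) \<and> w' \<cdot> (m \<cdot> e) = h"
      then have W': "w' \<in> arr C" "src C w' = tgt C m" "tgt C w' = tgt C h"
        using M E m by (auto simp: hom_def)
      have "w' \<cdot> m = w"
        by (rule coequalizer_epi[OF ce, of _ "tgt C h"])
      (use w' W' w M E m W in \<open>simp_all add: hom_def\<close>)
      then have "w \<cdot> n = w' \<cdot> (m \<cdot> n)" using W' M N by auto
      then show "w' = w \<cdot> n" using n W' by simp
    qed
  qed (use E M m in auto)
qed

text \<open>Generalized elements \<open>a\<close>, \<open>b\<close> of the image lift along
  \<open>e\<close> after passing to a cover of their domain. If \<open>m\<close> identifies them,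
  the lifts form an element of the kernel pair of \<open>f\<close>, which \<open>e\<close>
  coequalizes. Covers are epic, so \<open>a = b\<close>.\<close>

lemma regular_image_mono:
  assumes reg: "regular_category C" and kp: "is_pullback C f f u v" and ce: "is_coequalizer C u v e"
    and m: "m \<in> hom C (tgt C e) (tgt C f)" "m \<cdot> e = f"
  shows "is_mono C m"
  unfolding is_mono_def
proof (intro conjI ballI impI)
  show "m \<in> arr C" using homD(1)[OF m(1)] .
next
  fix a b
  assume ab: "a \<in> arr C" "b \<in> arr C"
    "src C a = src C b \<and> tgt C a = src C m \<and> tgt C b = src C m \<and> m \<cdot> a = m \<cdot> b"
  have pbs: "has_pullbacks C" and stable: "\<And>f g p q. is_pullback C f g p q \<Longrightarrow> is_regular_epi C g \<Longrightarrow> is_regular_epi C p"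
    using reg unfolding regular_category_def finitely_complete_def by blast+
  have re: "is_regular_epi C e" using ce unfolding is_regular_epi_def by blast
  have E: "u \<in> arr C" "v \<in> arr C" "src C u = src C v" "tgt C u = tgt C v" "e \<in> arr C"
    "src C e = tgt C u" "e \<cdot> u = e \<cdot> v"
    using ce unfolding is_coequalizer_def by auto
  have F: "f \<in> arr C" "tgt C u = src C f" "f \<cdot> u = f \<cdot> v"
    using kp unfolding is_pullback_def by auto
  note M = homD[OF m(1)]
  \<comment> \<open>The first cover \<open>x1\<close> lifts \<open>a\<close>; the second cover,
    taken over the first, lifts \<open>b\<close>. Both are regular epimorphisms by
    stability.\<close>
  obtain x1 a1 where pb1: "is_pullback C a e x1 a1"
    using pbs ab E M unfolding has_pullbacks_def by metis
  note X1 = homD[OF pullbackD(3)[OF pb1]] homD[OF pullbackD(4)[OF pb1]]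
  note sq1 = pullbackD(5)[OF pb1]
  have "tgt C (b \<cdot> x1) = tgt C e" using ab M X1 by simp
  then obtain x2 b2 where pb2: "is_pullback C (b \<cdot> x1) e x2 b2"
    using pbs ab E M X1 unfolding has_pullbacks_def by (metis arr_cmp(1))
  note X2 = homD[OF pullbackD(3)[OF pb2]] homD[OF pullbackD(4)[OF pb2]]
  note sq2 = pullbackD(5)[OF pb2]
  have s: "src C (b \<cdot> x1) = src C x1" using ab X1 by simp
  have "f \<cdot> (a1 \<cdot> x2) = m \<cdot> (e \<cdot> (a1 \<cdot> x2))"
    using m(2) M E F X1 X2 s by (subst cmp_cong_right1[OF m(2)]) auto
  also have "e \<cdot> (a1 \<cdot> x2) = a \<cdot> (x1 \<cdot> x2)"
    by (rule cmp_cong_right) (use sq1 X1 X2 E ab s in auto)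
  also have "m \<cdot> (a \<cdot> (x1 \<cdot> x2)) = m \<cdot> (b \<cdot> (x1 \<cdot> x2))"
    using X1 X2 E M ab s by (intro cmp_cong_right) auto
  also have "b \<cdot> (x1 \<cdot> x2) = e \<cdot> b2"
    using sq2 X1 X2 E M ab s by simp
  also have "m \<cdot> (e \<cdot> b2) = f \<cdot> b2"
    using m(2) M E F X1 X2 s by (subst cmp_cong_right1[OF m(2)]) auto
  finally have eq: "f \<cdot> (a1 \<cdot> x2) = f \<cdot> b2" .
  obtain w where w: "w \<in> hom C (src C x2) (src C u)" "u \<cdot> w = a1 \<cdot> x2" "v \<cdot> w = b2"
    using pullback_lift[OF kp _ _ eq] X1 X2 s E F by (auto simp: hom_def)
  note W = homD[OF w(1)]
  have "a \<cdot> (x1 \<cdot> x2) = e \<cdot> (a1 \<cdot> x2)"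
    by (rule cmp_cong_right) (use sq1 X1 X2 E ab s in auto)
  also have "\<dots> = e \<cdot> (u \<cdot> w)" using w by simp
  also have "\<dots> = e \<cdot> (v \<cdot> w)" using E W by (intro cmp_cong_right) auto
  also have "\<dots> = b \<cdot> (x1 \<cdot> x2)" using w sq2 X1 X2 E M ab s by simp
  finally have eq2: "a \<cdot> (x1 \<cdot> x2) = b \<cdot> (x1 \<cdot> x2)" .
  have eq3: "a \<cdot> x1 = b \<cdot> x1"
    by (rule regular_epi_epi[OF stable[OF pb2 re], of _ "tgt C a"])
      (use eq2 X1 X2 E M ab s in \<open>auto simp: hom_def\<close>)
  show "a = b"
    by (rule regular_epi_epi[OF stable[OF pb1 re], of _ "tgt C a"])
      (use eq3 X1 X2 E M ab in \<open>auto simp: hom_def\<close>)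
qed

section \<open>Points in a protomodular category\<close>

lemma jointly_extremally_epicD:
  assumes "jointly_extremally_epic C g s" "is_mono C m" "tgt C m = tgt C g"
    and "g' \<in> hom C (src C g) (src C m)" "m \<cdot> g' = g"
    and "s' \<in> hom C (src C s) (src C m)" "m \<cdot> s' = s"
  shows "is_iso C m"
  using assms unfolding jointly_extremally_epic_def by blast

text \<open>Conservativity of the change-of-base functors between fibres of the fibration of points.\<close>

lemma protomodular_conservative:
  assumes pm: "protomodular C" and pbs: "has_pullbacks C" and split: "is_split_epi C p s"
    and \<phi>: "\<phi> \<in> hom C (src C p) (src C \<pi>)" and \<pi>: "\<pi> \<in> arr C" "\<pi> \<cdot> \<phi> = p"
    and pb: "is_pullback C v p n g" and pb': "is_pullback C v \<pi> n (\<phi> \<cdot> g)"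
  shows "is_iso C \<phi>"
proof -
  have S: "p \<in> arr C" "s \<in> arr C" "src C s = tgt C p" "tgt C s = src C p" "p \<cdot> s = idn C (tgt C p)"
    using split unfolding is_split_epi_def by (auto simp: hom_def)
  note P = homD[OF \<phi>]
  have T: "tgt C \<pi> = tgt C p" using arr_cmp(3)[of \<phi> \<pi>] \<pi> P by simp
  note V = homD[OF pullbackD(1)[OF pb]] homD[OF pullbackD(2)[OF pb]]
    homD[OF pullbackD(3)[OF pb]] homD[OF pullbackD(4)[OF pb]] pullbackD(5)[OF pb]
  \<comment> \<open>First \<open>\<phi>\<close> is shown to be monic: its kernel pair is proved
    trivial by showing that the diagonal \<open>d\<close> is invertible.\<close>
  obtain a b where kp: "is_pullback C \<phi> \<phi> a b"
    using pbs P unfolding has_pullbacks_def by metis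
  note A = homD[OF pullbackD(3)[OF kp]] homD[OF pullbackD(4)[OF kp]] pullbackD(5)[OF kp]
  obtain d where d: "d \<in> hom C (src C p) (src C a)" "a \<cdot> d = idn C (src C p)" "b \<cdot> d = idn C (src C p)"
    using pullback_lift[OF kp, of "idn C (src C p)" "src C p" "idn C (src C p)"] P S
    by (auto simp: hom_def)
  note D = homD[OF d(1)]
  have pa: "p \<cdot> a = p \<cdot> b"
  proof -
    have "p \<cdot> a = \<pi> \<cdot> (\<phi> \<cdot> a)" using \<pi> P A by (subst cmp_cong_right1[OF \<pi>(2)]) auto
    also have "\<dots> = \<pi> \<cdot> (\<phi> \<cdot> b)" using A by simp
    also have "\<dots> = p \<cdot> b" using \<pi> P A by (subst cmp_cong_right1[OF \<pi>(2)]) auto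
    finally show ?thesis .
  qed
  \<comment> \<open>The kernel pair of \<open>\<phi>\<close> is itself a point over the base of
    \<open>p\<close>, with section \<open>d s\<close>, so protomodularity applies to its pullback
    along \<open>v\<close>.\<close>
  have split_pa: "is_split_epi C (p \<cdot> a) (d \<cdot> s)"
    unfolding is_split_epi_def using P A D S cmp_cong_right1[OF d(2), of s] by (auto simp: hom_def)
  obtain n2 g2 where pb2: "is_pullback C v (p \<cdot> a) n2 g2"
    using pm split_pa V A P unfolding protomodular_def by (metis arr_cmp(3))
  have jee: "jointly_extremally_epic C g2 (d \<cdot> s)"
    using pm split_pa pb2 V A P unfolding protomodular_def by (metis arr_cmp(3))
  have spa: "src C (p \<cdot> a) = src C a" using A P V by simp
  note G2 = homD[OF pullbackD(3)[OF pb2]] homD[OF pullbackD(4)[OF pb2]] pullbackD(5)[OF pb2] spa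
  have e1: "v \<cdot> n2 = p \<cdot> (a \<cdot> g2)" using G2 V A P by simp
  have e2: "v \<cdot> n2 = p \<cdot> (b \<cdot> g2)" using e1 pa G2 V A P cmp_cong_right[OF pa, of g2] by simp
  obtain k1 where k1: "k1 \<in> hom C (src C n2) (src C n)" "n \<cdot> k1 = n2" "g \<cdot> k1 = a \<cdot> g2"
    using pullback_lift[OF pb _ _ e1] G2 A P by (auto simp: hom_def)
  obtain k2 where k2: "k2 \<in> hom C (src C n2) (src C n)" "n \<cdot> k2 = n2" "g \<cdot> k2 = b \<cdot> g2"
    using pullback_lift[OF pb _ _ e2] G2 A P by (auto simp: hom_def)
  note K = homD[OF k1(1)] homD[OF k2(1)]
  \<comment> \<open>Over \<open>v\<close> the arrow \<open>\<phi>\<close> induces the identity,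
    because both squares have the same apex. Hence \<open>k1\<close> and \<open>k2\<close> coincide,
    and the two projections agree after restriction along \<open>g2\<close>.\<close>
  have "\<phi> \<cdot> (a \<cdot> g2) = \<phi> \<cdot> (b \<cdot> g2)" using A P G2 by (intro cmp_cong_right) auto
  then have "(\<phi> \<cdot> g) \<cdot> k1 = (\<phi> \<cdot> g) \<cdot> k2" using k1 k2 K V P by simp
  then have "k1 = k2" using pullback_unique[OF pb'] k1 k2 by metis
  then have ag: "a \<cdot> g2 = b \<cdot> g2" using k1 k2 by simp
  have dag: "d \<cdot> (a \<cdot> g2) = g2"
  proof (rule pullback_unique[OF kp, of _ "src C g2"])
    show "a \<cdot> (d \<cdot> (a \<cdot> g2)) = a \<cdot> g2"
      using d D A P G2 by (subst cmp_cong_right1[OF d(2)]) auto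
    show "b \<cdot> (d \<cdot> (a \<cdot> g2)) = b \<cdot> g2"
      using d D A P G2 ag by (subst cmp_cong_right1[OF d(3)]) auto
  qed (use D A P G2 in \<open>auto simp: hom_def\<close>)
  have mono_d: "is_mono C d"
    using split_mono[OF d(1) _ d(2)] A P by (auto simp: hom_def)
  \<comment> \<open>Both \<open>g2\<close> and \<open>d s\<close> factor through the split
    monomorphism \<open>d\<close>, while they are jointly extremally epic.\<close>
  have "is_iso C d"
    by (rule jointly_extremally_epicD[OF jee mono_d _ _ dag])
      (use D A G2 S P in \<open>auto simp: hom_def\<close>)
  then obtain d' where d': "d' \<in> hom C (tgt C d) (src C d)" "d \<cdot> d' = idn C (tgt C d)"
    using isoE by metis
  note D' = homD[OF d'(1)]
  have "a = a \<cdot> (d \<cdot> d')" using d' D A by simp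
  also have "\<dots> = b \<cdot> (d \<cdot> d')" using d D D' A P by (intro cmp_cong_right) auto
  also have "\<dots> = b" using d' D A by simp
  finally have ab: "a = b" .
  have mono: "is_mono C \<phi>"
    unfolding is_mono_def
  proof (intro conjI ballI impI)
    show "\<phi> \<in> arr C" using P by simp
  next
    fix x y
    assume xy: "x \<in> arr C" "y \<in> arr C"
      "src C x = src C y \<and> tgt C x = src C \<phi> \<and> tgt C y = src C \<phi> \<and> \<phi> \<cdot> x = \<phi> \<cdot> y"
    have x: "x \<in> hom C (src C x) (src C \<phi>)" and y: "y \<in> hom C (src C x) (src C \<phi>)"
      and eq: "\<phi> \<cdot> x = \<phi> \<cdot> y"
      using xy by (auto simp: hom_def)
    obtain w where "a \<cdot> w = x" "b \<cdot> w = y" using pullback_lift[OF kp x y eq] .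
    then show "x = y" using ab by simp
  qed
  \<comment> \<open>Second use of protomodularity, now for the point \<open>\<pi>\<close>: its fibre
    inclusion \<open>\<phi> g\<close> and its section \<open>\<phi> s\<close> both factor through
    \<open>\<phi>\<close>, which is already known to be monic.\<close>
  have "is_split_epi C \<pi> (\<phi> \<cdot> s)"
    unfolding is_split_epi_def using P S \<pi> T cmp_cong_right1[OF \<pi>(2), of s] by (auto simp: hom_def)
  then have jee': "jointly_extremally_epic C (\<phi> \<cdot> g) (\<phi> \<cdot> s)"
    using pm pb' V T unfolding protomodular_def by metis
  show ?thesis
    by (rule jointly_extremally_epicD[OF jee' mono]) (use P S V in \<open>auto simp: hom_def\<close>)
qed

lemma pullback_iso:
  assumes pb: "is_pullback C f g p q" and i: "is_iso C i" "tgt C i = src C p"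
  shows "is_pullback C f g (p \<cdot> i) (q \<cdot> i)"
proof -
  note D = homD[OF pullbackD(1)[OF pb]] homD[OF pullbackD(2)[OF pb]]
    homD[OF pullbackD(3)[OF pb]] homD[OF pullbackD(4)[OF pb]] pullbackD(5)[OF pb]
  obtain j where j: "j \<in> hom C (tgt C i) (src C i)" "i \<cdot> j = idn C (tgt C i)"
    using isoE[OF i(1)] by metis
  have I: "i \<in> arr C" using i unfolding is_iso_def by auto
  note J = homD[OF j(1)]
  show ?thesis
  proof (rule pullbackI)
    show "f \<cdot> (p \<cdot> i) = g \<cdot> (q \<cdot> i)" using D I i by (intro cmp_cong_right) auto
  next
    fix X u v assume uv: "u \<in> hom C X (src C f)" "v \<in> hom C X (src C g)" "f \<cdot> u = g \<cdot> v"
    obtain w where w: "w \<in> hom C X (src C p)" "p \<cdot> w = u" "q \<cdot> w = v"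
      using pullback_lift[OF pb uv] .
    note W = homD[OF w(1)]
    show "\<exists>w\<in>hom C X (src C i). (p \<cdot> i) \<cdot> w = u \<and> (q \<cdot> i) \<cdot> w = v"
      using w W D I J i cmp_cong_right1[OF j(2), of w]
      by (intro bexI[of _ "j \<cdot> w"]) (auto simp: hom_def)
  next
    fix X w w'
    assume w: "w \<in> hom C X (src C i)" "w' \<in> hom C X (src C i)"
      "(p \<cdot> i) \<cdot> w = (p \<cdot> i) \<cdot> w'" "(q \<cdot> i) \<cdot> w = (q \<cdot> i) \<cdot> w'"
    note W = homD[OF w(1)] homD[OF w(2)]
    have "i \<cdot> w = i \<cdot> w'"
      by (rule pullback_unique[OF pb, of _ X])
      (use w W D I i in \<open>auto simp: hom_def\<close>)
    then show "w = w'" using monoD[OF iso_mono[OF i(1)]] w by blast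
  qed (use D I i in \<open>auto simp: hom_def\<close>)
qed

end

section \<open>Zero objects\<close>

locale zero_objects = category C for C :: "('o, 'm) cat" (structure) +
  fixes \<Z> :: "'o set" and Zr :: "('o, 'm, 'o, 'm) func" and \<epsilon> :: "'o \<Rightarrow> 'm"
  assumes zero_objects: "class_of_zero_objects C \<Z> Zr \<epsilon>"
begin

section \<open>The coreflection onto the zero objects\<close>

lemma zero_obj: "W \<in> \<Z> \<Longrightarrow> W \<in> obj C"
  using zero_objects unfolding class_of_zero_objects_def replete_def by blast

lemma posetal:
  assumes "A \<in> \<Z>" "B \<in> \<Z>" "f \<in> hom C A B" "g \<in> hom C A B"
  shows "f = g"
  using zero_objects assms unfolding class_of_zero_objects_def by blast

lemma coreflection: "\<exists>\<eta>. adjunction (full_sub C \<Z>) C id_func Zr \<eta> \<epsilon>"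
  using zero_objects unfolding class_of_zero_objects_def by blast

lemma counit_hom: "A \<in> obj C \<Longrightarrow> \<epsilon> A \<in> hom C (onObj Zr A) A"
  using coreflection by (auto simp: adjunction_def nat_trans_def comp_func_def id_func_def)

lemma counit_mono: "A \<in> obj C \<Longrightarrow> is_mono C (\<epsilon> A)"
  using zero_objects unfolding class_of_zero_objects_def by blast

lemma coreflector_mono: "is_mono C m \<Longrightarrow> is_iso C (onArr Zr m)"
  using zero_objects unfolding class_of_zero_objects_def by blast

lemma coreflector_obj: "A \<in> obj C \<Longrightarrow> onObj Zr A \<in> \<Z>"
  using coreflection by (auto simp: adjunction_def is_functor_def full_sub_def)

lemma coreflector_arr:
  assumes "f \<in> hom C A B"
  shows "onArr Zr f \<in> hom C (onObj Zr A) (onObj Zr B)" "\<epsilon> B \<cdot> onArr Zr f = f \<cdot> \<epsilon> A"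
proof -
  have "is_functor C (full_sub C \<Z>) Zr" and nat: "nat_trans C C (comp_func id_func Zr) id_func \<epsilon>"
    using coreflection unfolding adjunction_def by blast+
  then have "onArr Zr f \<in> hom (full_sub C \<Z>) (onObj Zr (src C f)) (onObj Zr (tgt C f))"
    using homD[OF assms] unfolding is_functor_def by blast
  then show "onArr Zr f \<in> hom C (onObj Zr A) (onObj Zr B)"
    using homD[OF assms] by (simp add: hom_def full_sub_def)
  have "f \<cdot> \<epsilon> (src C f) = \<epsilon> (tgt C f) \<cdot> onArr Zr f"
    using nat homD(1)[OF assms] by (simp add: nat_trans_def comp_func_def id_func_def)
  then show "\<epsilon> B \<cdot> onArr Zr f = f \<cdot> \<epsilon> A"
    using homD[OF assms] by simp
qed

text \<open>The lift is the transpose \<open>Zr(h) \<eta>_W\<close> of \<open>h\<close>; naturality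
  of the counit and the triangle identity at \<open>W\<close> show that it lies over
  \<open>h\<close>.\<close>

lemma from_zero_lift:
  assumes W: "W \<in> \<Z>" and h: "h \<in> hom C W A"
  obtains j where "j \<in> hom C W (onObj Zr A)" "\<epsilon> A \<cdot> j = h"
proof -
  obtain \<eta> where adj: "adjunction (full_sub C \<Z>) C id_func Zr \<eta> \<epsilon>" using coreflection by blast
  have W': "W \<in> obj (full_sub C \<Z>)" using W zero_obj by (simp add: full_sub_def)
  then have "\<eta> W \<in> hom (full_sub C \<Z>) W (onObj Zr W)" and unit: "\<epsilon> W \<cdot> \<eta> W = idn C W"
    using adj by (auto simp: adjunction_def nat_trans_def comp_func_def id_func_def)
  then have \<eta>: "\<eta> W \<in> hom C W (onObj Zr W)" by (simp add: full_sub_def hom_def)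
  note Zh = coreflector_arr[OF h]
  note \<epsilon>W = homD[OF counit_hom[OF zero_obj[OF W]]]
  have A: "A \<in> obj C" using obj_src_tgt(2)[OF homD(1)[OF h]] homD[OF h] by simp
  note \<epsilon>A = homD[OF counit_hom[OF A]]
  have "\<epsilon> A \<cdot> (onArr Zr h \<cdot> \<eta> W) = h \<cdot> (\<epsilon> W \<cdot> \<eta> W)"
    by (rule cmp_cong_right[OF Zh(2)]) (use homD[OF Zh(1)] homD[OF \<eta>] homD[OF h] \<epsilon>W \<epsilon>A in auto)
  also have "\<dots> = h" using unit homD[OF h] by simp
  finally show thesis
    using that[OF cmp_hom[OF \<eta> Zh(1)]] by simp
qed

section \<open>Null arrows and subobjects of zero objects\<close>

text \<open>Every arrow from a zero object to \<open>B\<close> passes through the counit, so the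
  unspecified zero object in the definition may always be taken to be the coreflection of the
  target.\<close>

lemma null_arrow_iff:
  assumes f: "f \<in> hom C A B"
  shows "f \<in> null_arrows C \<Z> \<longleftrightarrow> (\<exists>c\<in>hom C A (onObj Zr B). f = \<epsilon> B \<cdot> c)"
proof
  note F = homD[OF f]
  have B: "B \<in> obj C" using F by auto
  assume "f \<in> null_arrows C \<Z>"
  then obtain W u v where W: "W \<in> \<Z>" and u: "u \<in> hom C A W" and v: "v \<in> hom C W B" and "f = v \<cdot> u"
    using F unfolding null_arrows_def by auto
  moreover obtain j where j: "j \<in> hom C W (onObj Zr B)" "\<epsilon> B \<cdot> j = v"
    using from_zero_lift[OF W v] .
  moreover have "\<epsilon> B \<cdot> (j \<cdot> u) = v \<cdot> u"
    by (rule cmp_cong_right1[OF j(2)])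
      (use homD[OF j(1)] homD[OF u] homD[OF counit_hom[OF B]] in auto)
  ultimately show "\<exists>c\<in>hom C A (onObj Zr B). f = \<epsilon> B \<cdot> c"
    using cmp_hom by metis
next
  note F = homD[OF f]
  have B: "B \<in> obj C" using F by auto
  assume "\<exists>c\<in>hom C A (onObj Zr B). f = \<epsilon> B \<cdot> c"
  then show "f \<in> null_arrows C \<Z>"
    using coreflector_obj[OF B] counit_hom[OF B] F unfolding null_arrows_def by auto
qed

lemma from_zero_null: "W \<in> \<Z> \<Longrightarrow> f \<in> hom C W A \<Longrightarrow> f \<in> null_arrows C \<Z>"
  using from_zero_lift null_arrow_iff by metis

lemma null_arrow_comp:
  assumes f: "f \<in> null_arrows C \<Z>" and h: "h \<in> arr C" "tgt C f = src C h"
  shows "h \<cdot> f \<in> null_arrows C \<Z>"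
proof -
  have fa: "f \<in> hom C (src C f) (tgt C f)" using f by (simp add: null_arrows_def hom_def)
  note F = homD[OF fa]
  have B: "tgt C f \<in> obj C" using F by simp
  have hh: "h \<in> hom C (tgt C f) (tgt C h)" using h by (simp add: hom_def)
  obtain c where c: "c \<in> hom C (src C f) (onObj Zr (tgt C f))" "f = \<epsilon> (tgt C f) \<cdot> c"
    using f null_arrow_iff[OF fa] by blast
  note Zh = coreflector_arr[OF hh]
  have "tgt C h \<in> obj C" using h by simp
  note T = homD[OF c(1)] homD[OF Zh(1)] homD[OF counit_hom[OF B]] homD[OF counit_hom[OF this]]
  have "h \<cdot> f = h \<cdot> (\<epsilon> (tgt C f) \<cdot> c)" using c(2) by (rule arg_cong)
  also have "\<dots> = \<epsilon> (tgt C h) \<cdot> (onArr Zr h \<cdot> c)"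
    by (rule cmp_cong_right[OF Zh(2)[symmetric]]) (use T h in auto)
  finally have "h \<cdot> f = \<epsilon> (tgt C h) \<cdot> (onArr Zr h \<cdot> c)" .
  then show ?thesis
    using null_arrow_iff[OF cmp_hom[OF fa hh]] cmp_hom[OF c(1) Zh(1)] by blast
qed

text \<open>Inverting \<open>Zr(m)\<close> produces an arrow from \<open>W\<close> back to
  \<open>A\<close>. It is a section of \<open>m\<close> because the zero objects are posetal, and a
  monomorphism with a section is invertible.\<close>

lemma mono_into_zero_iso:
  assumes m: "is_mono C m" "m \<in> hom C A W" and W: "W \<in> \<Z>"
  shows "is_iso C m"
proof -
  have A: "A \<in> obj C" using homD[OF m(2)] by auto
  note Zm = homD[OF coreflector_arr(1)[OF m(2)]]
  obtain j where j: "j \<in> hom C W (onObj Zr W)"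
    using from_zero_lift[OF W idn_hom[OF zero_obj[OF W]]] by metis
  obtain n where n: "n \<in> hom C (onObj Zr W) (onObj Zr A)"
    using isoE[OF coreflector_mono[OF m(1)]] Zm by metis
  have r: "\<epsilon> A \<cdot> (n \<cdot> j) \<in> hom C W A"
    using cmp_hom[OF cmp_hom[OF j n] counit_hom[OF A]] .
  have "m \<cdot> (\<epsilon> A \<cdot> (n \<cdot> j)) = idn C W"
    using posetal[OF W W cmp_hom[OF r m(2)] idn_hom[OF zero_obj[OF W]]] .
  then show ?thesis using mono_split_epi_iso[OF m r] by blast
qed

text \<open>The image of an arrow into a zero object is a subobject of it, hence everything.\<close>

lemma into_zero_regular_epi:
  assumes reg: "regular_category C" and w: "w \<in> hom C A W" and W: "W \<in> \<Z>"
  shows "is_regular_epi C w"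
proof -
  note w' = homD[OF w]
  have "has_pullbacks C" using reg unfolding regular_category_def finitely_complete_def by blast
  then obtain u v where kp: "is_pullback C w w u v"
    using w' unfolding has_pullbacks_def by metis
  then obtain e where ce: "is_coequalizer C u v e"
    using reg unfolding regular_category_def by blast
  have u: "tgt C u = A" using homD[OF pullbackD(3)[OF kp]] w' by simp
  obtain m where m: "m \<in> hom C (tgt C e) W" "m \<cdot> e = w"
    using coequalizer_lift[OF ce, of w W] pullbackD(5)[OF kp] w u by blast
  have "is_mono C m" using regular_image_mono[OF reg kp ce] m w' by simp
  then have "is_iso C m" using mono_into_zero_iso m(1) W by blast
  then have "is_coequalizer C u v w"
    using coequalizer_iso_comp[OF ce] homD[OF m(1)] m(2) by blast
  then show ?thesis unfolding is_regular_epi_def by blast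
qed

section \<open>Kernels relative to the zero objects\<close>

lemma zkernel_universal:
  assumes k: "is_zkernel C \<Z> f k" and e: "e \<in> hom C X (src C f)" "f \<cdot> e \<in> null_arrows C \<Z>"
  shows "\<exists>!u. u \<in> hom C X (src C k) \<and> k \<cdot> u = e"
proof -
  have "\<forall>e\<in>arr C. tgt C e = src C f \<and> f \<cdot> e \<in> null_arrows C \<Z> \<longrightarrow>
        (\<exists>!u. u \<in> hom C (src C e) (src C k) \<and> k \<cdot> u = e)"
    using k unfolding is_zkernel_def by (elim conjE)
  from this[rule_format, OF homD(1)[OF e(1)]] show ?thesis
    using e(2) homD[OF e(1)] by simp
qed

text \<open>Any composite \<open>k u\<close> is again annihilated by \<open>f\<close>, so the
  uniqueness clause of the kernel applies to it.\<close>

lemma zkernel_mono: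
  assumes k: "is_zkernel C \<Z> f k"
  shows "is_mono C k"
  unfolding is_mono_def
proof (intro conjI ballI impI)
  have K: "f \<in> arr C" "k \<in> arr C" "tgt C k = src C f" "f \<cdot> k \<in> null_arrows C \<Z>"
    using k unfolding is_zkernel_def by auto
  then show "k \<in> arr C" by simp
  fix u v
  assume uv: "u \<in> arr C" "v \<in> arr C"
    "src C u = src C v \<and> tgt C u = src C k \<and> tgt C v = src C k \<and> k \<cdot> u = k \<cdot> v"
  have n: "f \<cdot> k \<in> hom C (src C k) (tgt C f)" using K by (simp add: hom_def)
  have B: "tgt C f \<in> obj C" using K by simp
  obtain c where c: "c \<in> hom C (src C k) (onObj Zr (tgt C f))" "f \<cdot> k = \<epsilon> (tgt C f) \<cdot> c"
    using K(4) null_arrow_iff[OF n] by blast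
  have cu: "c \<cdot> u \<in> hom C (src C u) (onObj Zr (tgt C f))"
    using homD[OF c(1)] uv by (simp add: hom_def)
  have "f \<cdot> (k \<cdot> u) = \<epsilon> (tgt C f) \<cdot> (c \<cdot> u)"
    by (rule cmp_cong_right[OF c(2)]) (use homD[OF c(1)] uv K homD[OF counit_hom[OF B]] in auto)
  moreover have "f \<cdot> (k \<cdot> u) \<in> hom C (src C u) (tgt C f)" using uv K by (simp add: hom_def)
  ultimately have "f \<cdot> (k \<cdot> u) \<in> null_arrows C \<Z>" using null_arrow_iff cu by blast
  moreover have "k \<cdot> u \<in> hom C (src C u) (src C f)" using uv K by (simp add: hom_def)
  ultimately have "\<exists>!x. x \<in> hom C (src C u) (src C k) \<and> k \<cdot> x = k \<cdot> u"
    using zkernel_universal[OF k] by blast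
  moreover have "u \<in> hom C (src C u) (src C k)" "v \<in> hom C (src C u) (src C k)" "k \<cdot> v = k \<cdot> u"
    using uv by (auto simp: hom_def)
  ultimately show "u = v" by metis
qed

text \<open>The kernel is the pullback of the counit \<open>\<epsilon> B\<close> along
  \<open>f\<close>. Since the counit is monic, the leg into \<open>A\<close> alone determines the
  factorisation.\<close>

lemma zkernel_exists:
  assumes pbs: "has_pullbacks C" and f: "f \<in> hom C A B"
  shows "\<exists>k. is_zkernel C \<Z> f k"
proof -
  note F = homD[OF f]
  have B: "B \<in> obj C" using F by auto
  note E = homD[OF counit_hom[OF B]]
  obtain c k where pb: "is_pullback C (\<epsilon> B) f c k"
    using pbs E F unfolding has_pullbacks_def by metis
  note D = homD[OF pullbackD(3)[OF pb]] homD[OF pullbackD(4)[OF pb]]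
  have "is_zkernel C \<Z> f k"
    unfolding is_zkernel_def
  proof (intro conjI ballI impI)
    have "f \<cdot> k \<in> hom C (src C k) B" using D F by (simp add: hom_def)
    moreover have "c \<in> hom C (src C k) (onObj Zr B)" using D E by (simp add: hom_def)
    ultimately show "f \<cdot> k \<in> null_arrows C \<Z>"
      using null_arrow_iff pullbackD(5)[OF pb] by metis
  next
    fix e assume e: "e \<in> arr C" "tgt C e = src C f \<and> f \<cdot> e \<in> null_arrows C \<Z>"
    have fe: "f \<cdot> e \<in> hom C (src C e) B" using e F by (simp add: hom_def)
    obtain d where d: "d \<in> hom C (src C e) (onObj Zr B)" "f \<cdot> e = \<epsilon> B \<cdot> d"
      using e null_arrow_iff[OF fe] by blast
    obtain u where u: "u \<in> hom C (src C e) (src C c)" "c \<cdot> u = d" "k \<cdot> u = e"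
      by (rule pullback_lift[OF pb, of d "src C e" e]) (use d E e in \<open>auto simp: hom_def\<close>)
    show "\<exists>!u. u \<in> hom C (src C e) (src C k) \<and> k \<cdot> u = e"
    proof (rule ex1I[of _ u])
      show "u \<in> hom C (src C e) (src C k) \<and> k \<cdot> u = e" using u D by simp
    next
      fix u' assume u': "u' \<in> hom C (src C e) (src C k) \<and> k \<cdot> u' = e"
      note U' = homD[OF conjunct1[OF u']]
      have "\<epsilon> B \<cdot> (c \<cdot> u') = f \<cdot> (k \<cdot> u')"
        by (rule cmp_cong_right[OF pullbackD(5)[OF pb]]) (use U' D E F in auto)
      also have "\<dots> = \<epsilon> B \<cdot> d" using u' d by simp
      finally have eq: "\<epsilon> B \<cdot> (c \<cdot> u') = \<epsilon> B \<cdot> d" .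
      have "c \<cdot> u' = d"
        by (rule monoD[OF counit_mono[OF B], of _ "src C e"])
          (use eq U' d D E in \<open>auto simp: hom_def\<close>)
      then show "u' = u"
        using u u' D by (metis pullback_unique[OF pb])
    qed
  qed (use D F in auto)
  then show ?thesis by blast
qed

end

section \<open>Torsion theories\<close>

locale zero_torsion_theory = zero_objects C \<Z> Zr \<epsilon>
  for C :: "('o, 'm) cat" (structure) and \<Z> Zr \<epsilon> +
  fixes \<T> \<F> :: "'o set" and t \<eta> :: "'o \<Rightarrow> 'm"
  assumes torsion_theory: "torsion_theory C \<Z> \<T> \<F> t \<eta>"
begin

abbreviation "F A \<equiv> tgt C (\<eta> A)"
abbreviation "Fa \<equiv> onArr (reflector C \<eta>)"

section \<open>The torsion sequence and the universal property of its unit\<close>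

lemma zero_torsion_free: "W \<in> \<Z> \<Longrightarrow> W \<in> \<F>"
  using torsion_theory unfolding torsion_theory_def by blast

lemma torsion_obj: "A \<in> \<T> \<Longrightarrow> A \<in> obj C" and torsion_free_obj: "A \<in> \<F> \<Longrightarrow> A \<in> obj C"
  using torsion_theory unfolding torsion_theory_def replete_def by blast+

lemma torsion_free_iso:
  assumes "A \<in> \<F>" "f \<in> hom C A B" "is_iso C f"
  shows "B \<in> \<F>"
proof -
  have "B \<in> obj C" using obj_src_tgt(2)[OF homD(1)[OF assms(2)]] homD(3)[OF assms(2)] by simp
  then show ?thesis
    using torsion_theory assms unfolding torsion_theory_def replete_def iso_objs_def by blast
qed

lemma torsion_to_torsion_free_null:
  "A \<in> \<T> \<Longrightarrow> B \<in> \<F> \<Longrightarrow> f \<in> hom C A B \<Longrightarrow> f \<in> null_arrows C \<Z>"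
  using torsion_theory unfolding torsion_theory_def by blast

lemma torsion_sequence:
  assumes "A \<in> obj C"
  shows "src C (t A) \<in> \<T>" "F A \<in> \<F>" "is_zkernel C \<Z> (\<eta> A) (t A)" "is_zcokernel C \<Z> (t A) (\<eta> A)"
    "t A \<in> hom C (src C (t A)) A" "\<eta> A \<in> hom C A (F A)"
proof -
  have *: "tgt C (t A) = A" "src C (\<eta> A) = A" "short_zexact C \<Z> (t A) (\<eta> A)"
    "src C (t A) \<in> \<T>" "F A \<in> \<F>"
    using torsion_theory assms unfolding torsion_theory_def by blast+
  then show "src C (t A) \<in> \<T>" "F A \<in> \<F>"
    and k: "is_zkernel C \<Z> (\<eta> A) (t A)" and "is_zcokernel C \<Z> (t A) (\<eta> A)"
    unfolding short_zexact_def by blast+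
  then show "t A \<in> hom C (src C (t A)) A" "\<eta> A \<in> hom C A (F A)"
    using * unfolding is_zkernel_def hom_def by auto
qed

lemma unit_universal:
  assumes A: "A \<in> obj C" and h: "h \<in> hom C A X" "h \<cdot> t A \<in> null_arrows C \<Z>"
  shows "\<exists>!u. u \<in> hom C (F A) X \<and> u \<cdot> \<eta> A = h"
proof -
  have "\<forall>e\<in>arr C. src C e = tgt C (t A) \<and> e \<cdot> t A \<in> null_arrows C \<Z> \<longrightarrow>
        (\<exists>!u. u \<in> hom C (F A) (tgt C e) \<and> u \<cdot> \<eta> A = e)"
    using torsion_sequence(4)[OF A] unfolding is_zcokernel_def by (elim conjE)
  from this[rule_format, OF homD(1)[OF h(1)]] show ?thesis
    using h(2) homD[OF h(1)] homD[OF torsion_sequence(5)[OF A]] by simp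
qed

text \<open>Any \<open>w \<eta>_A\<close> composes with \<open>t A\<close> to a null arrow, so the
  uniqueness clause of the cokernel applies to it.\<close>

lemma unit_epi:
  assumes A: "A \<in> obj C" and w: "w \<in> hom C (F A) X" "w' \<in> hom C (F A) X" "w \<cdot> \<eta> A = w' \<cdot> \<eta> A"
  shows "w = w'"
proof -
  note W = homD[OF w(1)] homD[OF torsion_sequence(5)[OF A]] homD[OF torsion_sequence(6)[OF A]]
  have "\<eta> A \<cdot> t A \<in> null_arrows C \<Z>"
    using torsion_sequence(3)[OF A] unfolding is_zkernel_def by blast
  then have "w \<cdot> (\<eta> A \<cdot> t A) \<in> null_arrows C \<Z>" by (rule null_arrow_comp) (use W in auto)
  then have "(w \<cdot> \<eta> A) \<cdot> t A \<in> null_arrows C \<Z>" using W by simp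
  moreover have "w \<cdot> \<eta> A \<in> hom C A X" using W by (simp add: hom_def)
  ultimately have "\<exists>!u. u \<in> hom C (F A) X \<and> u \<cdot> \<eta> A = w \<cdot> \<eta> A" using unit_universal[OF A] by blast
  then show ?thesis using w by metis
qed

text \<open>The composite of \<open>h\<close> with \<open>t A\<close> runs from a torsion object to
  a torsion-free one and is therefore null, so \<open>h\<close> factors through the cokernel
  \<open>\<eta> A\<close>.\<close>

lemma reflect:
  assumes Y: "Y \<in> \<F>" and h: "h \<in> hom C A Y"
  obtains w where "w \<in> hom C (F A) Y" "w \<cdot> \<eta> A = h"
proof -
  have A: "A \<in> obj C" using obj_src_tgt(1)[OF homD(1)[OF h]] homD(2)[OF h] by simp
  have "h \<cdot> t A \<in> null_arrows C \<Z>"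
    by (rule torsion_to_torsion_free_null[OF torsion_sequence(1)[OF A] Y
          cmp_hom[OF torsion_sequence(5)[OF A] h]])
  then show thesis using that unit_universal[OF A h] by blast
qed

text \<open>A retraction of an epimorphism is its inverse. This is the criterion by which objects
  are later recognised as torsion-free.\<close>

lemma unit_retraction_iso:
  assumes A: "A \<in> obj C" and r: "r \<in> hom C (F A) A" "r \<cdot> \<eta> A = idn C A"
  shows "is_iso C (\<eta> A)" "A \<in> \<F>"
proof -
  note E = torsion_sequence(6)[OF A]
  note R = homD[OF r(1)] homD[OF E]
  have "(\<eta> A \<cdot> r) \<cdot> \<eta> A = idn C (F A) \<cdot> \<eta> A" using r R by simp
  then have er: "\<eta> A \<cdot> r = idn C (F A)"
    by (rule unit_epi[OF A, of _ "F A", rotated 2]) (use R in \<open>auto simp: hom_def\<close>)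
  show "is_iso C (\<eta> A)" using isoI[OF E r(1) r(2) er] .
  show "A \<in> \<F>" using torsion_free_iso[OF torsion_sequence(2)[OF A] r(1) isoI[OF r(1) E er r(2)]] .
qed

lemma unit_iso: "A \<in> \<F> \<Longrightarrow> is_iso C (\<eta> A)"
  using reflect[OF _ idn_hom] unit_retraction_iso(1) torsion_free_obj by metis

text \<open>The unit \<open>\<eta> X\<close> is null, so it factors through the counit at
  \<open>F X\<close>. The factor lands in a torsion-free object and extends along
  \<open>\<eta> X\<close>, giving a section of the monic counit, which is thus invertible.\<close>

lemma torsion_reflection_zero:
  assumes X: "X \<in> \<T>"
  shows "F X \<in> \<Z>"
proof -
  have X': "X \<in> obj C" using torsion_obj[OF X] .
  note E = torsion_sequence(6)[OF X']
  have FX: "F X \<in> obj C" using torsion_free_obj[OF torsion_sequence(2)[OF X']] .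
  note c = counit_hom[OF FX]
  note Z = coreflector_obj[OF FX]
  obtain d where d: "d \<in> hom C X (onObj Zr (F X))" "\<eta> X = \<epsilon> (F X) \<cdot> d"
    using torsion_to_torsion_free_null[OF X torsion_sequence(2)[OF X'] E] null_arrow_iff[OF E] by blast
  obtain u where u: "u \<in> hom C (F X) (onObj Zr (F X))" "u \<cdot> \<eta> X = d"
    using reflect[OF zero_torsion_free[OF Z] d(1)] .
  note H = homD[OF c] homD[OF u(1)] homD[OF E]
  have "(\<epsilon> (F X) \<cdot> u) \<cdot> \<eta> X = idn C (F X) \<cdot> \<eta> X" using d(2) u(2) H by simp
  then have "\<epsilon> (F X) \<cdot> u = idn C (F X)"
    by (rule unit_epi[OF X', of _ "F X", rotated 2]) (use H in \<open>auto simp: hom_def\<close>)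
  then have "is_iso C (\<epsilon> (F X))"
    using mono_split_epi_iso[OF counit_mono[OF FX] c u(1)] by blast
  then show ?thesis
    using c Z FX zero_objects
    unfolding class_of_zero_objects_def replete_def iso_objs_def by blast
qed

lemma reflector_arr:
  assumes f: "f \<in> hom C A B"
  shows "Fa f \<in> hom C (F A) (F B)" "Fa f \<cdot> \<eta> A = \<eta> B \<cdot> f"
proof -
  note H = homD[OF f]
  have A: "A \<in> obj C" and B: "B \<in> obj C" using H by auto
  have ef: "\<eta> B \<cdot> f \<in> hom C A (F B)" using cmp_hom[OF f torsion_sequence(6)[OF B]] .
  obtain g where g: "g \<in> hom C (F A) (F B)" "g \<cdot> \<eta> A = \<eta> B \<cdot> f"
    using reflect[OF torsion_sequence(2)[OF B] ef] .
  have "\<exists>!g. g \<in> hom C (F A) (F B) \<and> g \<cdot> \<eta> A = \<eta> B \<cdot> f"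
    using g unit_epi[OF A] by metis
  from theI'[OF this] show "Fa f \<in> hom C (F A) (F B)" "Fa f \<cdot> \<eta> A = \<eta> B \<cdot> f"
    using H by (simp_all add: reflector_def)
qed

text \<open>The inclusion of a reflective subcategory preserves limits: cones from an arbitrary
  \<open>X\<close> extend uniquely along \<open>\<eta> X\<close> to cones from \<open>F X\<close>.
  This moves the pullbacks supplied by condition (P) into \<open>C\<close>.\<close>

lemma torsion_free_pullback:
  assumes pb: "is_pullback (full_sub C \<F>) f g p q"
  shows "is_pullback C f g p q"
proof -
  have ho: "hom (full_sub C \<F>) X Y = (if X \<in> \<F> \<and> Y \<in> \<F> then hom C X Y else {})" for X Y
    by (auto simp: hom_def full_sub_def)
  have fs: "src (full_sub C \<F>) = src C" "tgt (full_sub C \<F>) = tgt C" "cmp (full_sub C \<F>) = cmp C"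
    by (simp_all add: full_sub_def)
  have P: "f \<in> arr C" "g \<in> arr C" "p \<in> arr C" "q \<in> arr C" "src C f \<in> \<F>" "src C g \<in> \<F>" "tgt C f \<in> \<F>"
    "src C p \<in> \<F>" "tgt C f = tgt C g" "src C p = src C q" "tgt C p = src C f" "tgt C q = src C g"
    "f \<cdot> p = g \<cdot> q"
    using pb unfolding is_pullback_def full_sub_def by auto
  have univ: "\<exists>!w. w \<in> hom C X (src C p) \<and> p \<cdot> w = u \<and> q \<cdot> w = v"
    if X: "X \<in> \<F>" and u: "u \<in> hom C X (src C f)" and v: "v \<in> hom C X (src C g)" and "f \<cdot> u = g \<cdot> v"
    for X u v
  proof -
    have "\<forall>u\<in>arr (full_sub C \<F>). \<forall>v\<in>arr (full_sub C \<F>).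
      src C u = src C v \<and> tgt C u = src C f \<and> tgt C v = src C g \<and> f \<cdot> u = g \<cdot> v \<longrightarrow>
      (\<exists>!w. w \<in> hom (full_sub C \<F>) (src C u) (src C p) \<and> p \<cdot> w = u \<and> q \<cdot> w = v)"
      using pb unfolding is_pullback_def fs by (elim conjE)
    moreover have "u \<in> arr (full_sub C \<F>)" "v \<in> arr (full_sub C \<F>)"
      using homD[OF u] homD[OF v] X P by (auto simp: full_sub_def)
    moreover have "src C u = src C v \<and> tgt C u = src C f \<and> tgt C v = src C g \<and> f \<cdot> u = g \<cdot> v"
      using homD[OF u] homD[OF v] that by simp
    ultimately have "\<exists>!w. w \<in> hom (full_sub C \<F>) (src C u) (src C p) \<and> p \<cdot> w = u \<and> q \<cdot> w = v"
      by blast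
    then show ?thesis using homD[OF u] X P by (simp add: ho)
  qed
  show ?thesis
  proof (rule pullbackI[of _ "src C f" "tgt C f" _ "src C g" _ "src C p"])
    fix X u v assume uv: "u \<in> hom C X (src C f)" "v \<in> hom C X (src C g)" "f \<cdot> u = g \<cdot> v"
    have X: "X \<in> obj C" using homD[OF uv(1)] by auto
    obtain u' where u': "u' \<in> hom C (F X) (src C f)" "u' \<cdot> \<eta> X = u" using reflect[OF P(5) uv(1)] .
    obtain v' where v': "v' \<in> hom C (F X) (src C g)" "v' \<cdot> \<eta> X = v" using reflect[OF P(6) uv(2)] .
    note H = homD[OF torsion_sequence(6)[OF X]] homD[OF u'(1)] homD[OF v'(1)]
    have "(f \<cdot> u') \<cdot> \<eta> X = (g \<cdot> v') \<cdot> \<eta> X" using uv(3) u' v' P H by simp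
    then have "f \<cdot> u' = g \<cdot> v'"
      by (rule unit_epi[OF X, of _ "tgt C f", rotated 2]) (use H P in \<open>auto simp: hom_def\<close>)
    then obtain w where w: "w \<in> hom C (F X) (src C p)" "p \<cdot> w = u'" "q \<cdot> w = v'"
      using univ[OF torsion_sequence(2)[OF X] u'(1) v'(1)] by blast
    have "p \<cdot> (w \<cdot> \<eta> X) = u" "q \<cdot> (w \<cdot> \<eta> X) = v"
      using cmp_cong_right1[OF w(2), of "\<eta> X"] cmp_cong_right1[OF w(3), of "\<eta> X"] homD[OF w(1)] H P u' v'
      by simp_all
    then show "\<exists>w\<in>hom C X (src C p). p \<cdot> w = u \<and> q \<cdot> w = v"
      using cmp_hom[OF torsion_sequence(6)[OF X] w(1)] by blast
  next
    fix X w w'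
    assume w: "w \<in> hom C X (src C p)" "w' \<in> hom C X (src C p)" "p \<cdot> w = p \<cdot> w'" "q \<cdot> w = q \<cdot> w'"
    have X: "X \<in> obj C" using homD[OF w(1)] by auto
    obtain v where v: "v \<in> hom C (F X) (src C p)" "v \<cdot> \<eta> X = w" using reflect[OF P(8) w(1)] .
    obtain v' where v': "v' \<in> hom C (F X) (src C p)" "v' \<cdot> \<eta> X = w'" using reflect[OF P(8) w(2)] .
    note H = homD[OF torsion_sequence(6)[OF X]] homD[OF v(1)] homD[OF v'(1)]
    have "(p \<cdot> v) \<cdot> \<eta> X = (p \<cdot> v') \<cdot> \<eta> X" "(q \<cdot> v) \<cdot> \<eta> X = (q \<cdot> v') \<cdot> \<eta> X"
      using w v v' P H by simp_all
    then have eq: "p \<cdot> v = p \<cdot> v'" "q \<cdot> v = q \<cdot> v'"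
      using unit_epi[OF X, of "p \<cdot> v" "src C f" "p \<cdot> v'"] unit_epi[OF X, of "q \<cdot> v" "src C g" "q \<cdot> v'"] H P
      by (auto simp: hom_def)
    have "f \<cdot> (p \<cdot> v) = g \<cdot> (q \<cdot> v)"
      by (rule cmp_cong_right[OF P(13)]) (use H P in auto)
    then have "\<exists>!x. x \<in> hom C (F X) (src C p) \<and> p \<cdot> x = p \<cdot> v \<and> q \<cdot> x = q \<cdot> v"
      by (intro univ[OF torsion_sequence(2)[OF X]]) (use H P in \<open>auto simp: hom_def\<close>)
    then have "v = v'" using v(1) v'(1) eq by metis
    then show "w = w'" using v v' by simp
  qed (use P in \<open>auto simp: hom_def\<close>)
qed

section \<open>From a trivial pullback to a torsion-free kernel\<close>

text \<open>Pulling the torsion part \<open>t K\<close> back to \<open>E\<close> changes it only by a regular epimorphism, because all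
  arrows between zero objects are such; the resulting torsion object maps to \<open>P\<close>, and triviality of
  \<open>p\<close> forces this map to factor through a zero object.\<close>

lemma kernel_torsion_free_if_trivial_pullback:
  assumes reg: "regular_category C" and S: "condition_S C \<Z> \<T> \<eta>"
    and pb: "is_pullback C g f p q"
    and triv: "is_pullback C (\<eta> (src C g)) (Fa p) p (\<eta> (src C p))"
    and k: "is_zkernel C \<Z> f k"
  shows "src C k \<in> \<F>"
proof -
  define E A B P K where "E = src C g" and "A = src C f" and "B = tgt C f" and "P = src C p"
    and "K = src C k"
  have pbs: "has_pullbacks C"
    and stable: "\<And>f g p q. is_pullback C f g p q \<Longrightarrow> is_regular_epi C g \<Longrightarrow> is_regular_epi C p"
    using reg unfolding regular_category_def finitely_complete_def by blast+
  have tg: "tgt C g = B" using pb unfolding is_pullback_def B_def by simp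
  have g: "g \<in> hom C E B" and f: "f \<in> hom C A B" and p: "p \<in> hom C P E" and q: "q \<in> hom C P A"
    and sq: "g \<cdot> p = f \<cdot> q"
    using pullbackD[OF pb] tg unfolding E_def A_def P_def by (auto simp: hom_def B_def)
  have kh: "k \<in> hom C K A" and fk: "f \<cdot> k \<in> null_arrows C \<Z>"
    using k unfolding is_zkernel_def K_def A_def hom_def by auto
  have obj: "E \<in> obj C" "A \<in> obj C" "B \<in> obj C" "P \<in> obj C" "K \<in> obj C"
    using homD[OF g] homD[OF f] homD[OF p] homD[OF kh] by auto
  define T where "T = src C (t K)"
  have T: "T \<in> \<T>" and t: "t K \<in> hom C T K" using torsion_sequence[OF obj(5)] unfolding T_def by auto
  have T': "T \<in> obj C" using torsion_obj[OF T] .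
  note \<eta>T = torsion_sequence(6)[OF T']
  have FT: "F T \<in> \<Z>" using torsion_reflection_zero[OF T] .
  obtain c where c: "c \<in> hom C K (onObj Zr B)" "f \<cdot> k = \<epsilon> B \<cdot> c"
    using fk null_arrow_iff[OF cmp_hom[OF kh f]] by blast
  note ZB = coreflector_obj[OF obj(3)] and ZE = coreflector_obj[OF obj(1)]
  \<comment> \<open>\<open>Zr(B)\<close> is a zero object, hence torsion-free, so
    \<open>c t_K\<close> extends along the unit of \<open>T\<close>. The arrow \<open>c'\<close>
    between zero objects is what gets compared with \<open>Zr(g)\<close>.\<close>
  obtain c' where c': "c' \<in> hom C (F T) (onObj Zr B)" "c' \<cdot> \<eta> T = c \<cdot> t K"
    using reflect[OF zero_torsion_free[OF ZB] cmp_hom[OF t c(1)]] .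
  note Zg = coreflector_arr[OF g]
  obtain w1 w2 where W: "is_pullback C c' (onArr Zr g) w1 w2"
    using pbs homD[OF c'(1)] homD[OF Zg(1)] unfolding has_pullbacks_def by metis
  define X where "X = src C w1"
  have w1: "w1 \<in> hom C X (F T)" and w2: "w2 \<in> hom C X (onObj Zr E)"
    and wsq: "c' \<cdot> w1 = onArr Zr g \<cdot> w2"
    using pullbackD[OF W] homD[OF c'(1)] homD[OF Zg(1)] unfolding X_def by auto
  have X: "X \<in> obj C" using homD[OF w1] by auto
  \<comment> \<open>Precomposing with the counit at \<open>X\<close> replaces \<open>X\<close> by a
    zero object, as the arrow \<open>Z' \<rightarrow> Z\<close> in condition (S) requires.\<close>
  note \<epsilon>X = counit_hom[OF X] and ZX = coreflector_obj[OF X]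
  have z: "w1 \<cdot> \<epsilon> X \<in> hom C (onObj Zr X) (F T)" using cmp_hom[OF \<epsilon>X w1] .
  obtain \<chi> r where R: "is_pullback C (w1 \<cdot> \<epsilon> X) (\<eta> T) \<chi> r"
    using pbs homD[OF z] homD[OF \<eta>T] unfolding has_pullbacks_def by metis
  define Y where "Y = src C \<chi>"
  have \<chi>: "\<chi> \<in> hom C Y (onObj Zr X)" and r: "r \<in> hom C Y T" and rsq: "(w1 \<cdot> \<epsilon> X) \<cdot> \<chi> = \<eta> T \<cdot> r"
    using pullbackD[OF R] homD[OF z] homD[OF \<eta>T] unfolding Y_def by auto
  have Y: "Y \<in> obj C" using homD[OF \<chi>] by auto
  have "src C (w1 \<cdot> \<epsilon> X) \<in> \<Z> \<and> tgt C (w1 \<cdot> \<epsilon> X) = F T" using homD[OF z] ZX by simp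
  \<comment> \<open>Condition (S) identifies \<open>\<chi>\<close> with the unit of \<open>Y\<close>
    up to \<open>i\<close>. Therefore arrows from \<open>Y\<close> to torsion-free objects factor
    through \<open>\<chi>\<close>.\<close>
  then obtain i where i: "i \<in> hom C (F Y) (tgt C \<chi>)" "is_iso C i" "i \<cdot> \<eta> Y = \<chi>"
    using S T R homD(1)[OF z] unfolding condition_S_def Y_def by blast
  obtain j where j: "j \<in> hom C (onObj Zr X) (F Y)" "j \<cdot> i = idn C (F Y)"
    using isoE[OF i(2)] homD[OF i(1)] homD[OF \<chi>] by metis
  \<comment> \<open>\<open>r\<close> is the pullback of an arrow into the zero object
    \<open>F T\<close>, so it is a regular epimorphism by stability.\<close>
  have r_epi: "is_regular_epi C r"
    using stable[OF pullback_sym[OF R]] into_zero_regular_epi[OF reg z FT] .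
  have \<chi>_epi: "is_regular_epi C \<chi>" using into_zero_regular_epi[OF reg \<chi> ZX] .
  define e where "e = \<epsilon> E \<cdot> (w2 \<cdot> \<epsilon> X)"
  note \<epsilon>E = counit_hom[OF obj(1)] and \<epsilon>B = counit_hom[OF obj(3)]
  have e: "e \<in> hom C (onObj Zr X) E" unfolding e_def using cmp_hom[OF cmp_hom[OF \<epsilon>X w2] \<epsilon>E] .
  note H = homD[OF g] homD[OF f] homD[OF p] homD[OF q] homD[OF kh] homD[OF t] homD[OF \<eta>T] homD[OF c(1)]
    homD[OF c'(1)] homD[OF Zg(1)] homD[OF w1] homD[OF w2] homD[OF \<epsilon>X] homD[OF \<chi>] homD[OF r]
    homD[OF j(1)] homD[OF e] homD[OF \<epsilon>E] homD[OF \<epsilon>B] homD[OF i(1)]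
  have "g \<cdot> (e \<cdot> \<chi>) = g \<cdot> (\<epsilon> E \<cdot> (w2 \<cdot> (\<epsilon> X \<cdot> \<chi>)))" unfolding e_def using H by simp
  also have "\<dots> = \<epsilon> B \<cdot> (onArr Zr g \<cdot> (w2 \<cdot> (\<epsilon> X \<cdot> \<chi>)))"
    by (rule cmp_cong_right[OF Zg(2)[symmetric]]) (use H in simp_all)
  also have "onArr Zr g \<cdot> (w2 \<cdot> (\<epsilon> X \<cdot> \<chi>)) = c' \<cdot> (w1 \<cdot> (\<epsilon> X \<cdot> \<chi>))"
    by (rule cmp_cong_right[OF wsq[symmetric]]) (use H in simp_all)
  also have "w1 \<cdot> (\<epsilon> X \<cdot> \<chi>) = \<eta> T \<cdot> r" using rsq H by simp
  also have "c' \<cdot> (\<eta> T \<cdot> r) = c \<cdot> (t K \<cdot> r)"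
    by (rule cmp_cong_right[OF c'(2)]) (use H in simp_all)
  also have "\<epsilon> B \<cdot> (c \<cdot> (t K \<cdot> r)) = f \<cdot> (k \<cdot> (t K \<cdot> r))"
    by (rule cmp_cong_right[OF c(2)[symmetric]]) (use H in simp_all)
  finally have "g \<cdot> (e \<cdot> \<chi>) = f \<cdot> (k \<cdot> (t K \<cdot> r))" .
  \<comment> \<open>The arrow to \<open>E\<close> through \<open>Zr(X)\<close> and the arrow to
    \<open>A\<close> through \<open>K[f]\<close> agree over \<open>B\<close>, so they pair into the
    pullback \<open>P\<close>.\<close>
  then obtain h where h: "h \<in> hom C Y P" "p \<cdot> h = e \<cdot> \<chi>" "q \<cdot> h = k \<cdot> (t K \<cdot> r)"
    using pullback_lift[OF pb, of "e \<cdot> \<chi>" Y "k \<cdot> (t K \<cdot> r)"] H unfolding P_def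
    by (auto simp: hom_def)
  note \<eta>P = torsion_sequence(6)[OF obj(4)] and \<eta>E = torsion_sequence(6)[OF obj(1)]
    and \<eta>Y = torsion_sequence(6)[OF Y]
  note Fp = reflector_arr[OF p]
  obtain v' where v': "v' \<in> hom C (F Y) (F P)" "v' \<cdot> \<eta> Y = \<eta> P \<cdot> h"
    using reflect[OF torsion_sequence(2)[OF obj(4)] cmp_hom[OF h(1) \<eta>P]] .
  have v: "v' \<cdot> j \<in> hom C (onObj Zr X) (F P)" using cmp_hom[OF j(1) v'(1)] .
  note H' = H homD[OF h(1)] homD[OF \<eta>P] homD[OF \<eta>E] homD[OF \<eta>Y] homD[OF Fp(1)] homD[OF v'(1)]
  have "j \<cdot> \<chi> = \<eta> Y"
    using cmp_cong_right1[OF j(2), of "\<eta> Y"] i(3) H' by simp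
  then have v\<chi>: "(v' \<cdot> j) \<cdot> \<chi> = \<eta> P \<cdot> h" using v'(2) H' by simp
  have "\<eta> E \<cdot> (p \<cdot> h) = Fa p \<cdot> (\<eta> P \<cdot> h)"
    by (rule cmp_cong_right[OF Fp(2)[symmetric]]) (use H' in simp_all)
  then have "(\<eta> E \<cdot> e) \<cdot> \<chi> = (Fa p \<cdot> (v' \<cdot> j)) \<cdot> \<chi>" using h(2) v\<chi> H' by simp
  then have comm: "\<eta> E \<cdot> e = Fa p \<cdot> (v' \<cdot> j)"
    by (rule regular_epi_epi[OF \<chi>_epi, of _ "F E", rotated 2]) (use H' in \<open>simp_all add: hom_def\<close>)
  have triv': "is_pullback C (\<eta> E) (Fa p) p (\<eta> P)" using triv unfolding E_def P_def .
  \<comment> \<open>Triviality of \<open>p\<close> enters here: both components of \<open>h\<close>,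
    along \<open>p\<close> and along \<open>\<eta> P\<close>, factor through \<open>\<chi>\<close>,
    hence \<open>h\<close> itself factors through the zero object \<open>Zr(X)\<close>.\<close>
  obtain h' where h': "h' \<in> hom C (onObj Zr X) P" "p \<cdot> h' = e" "\<eta> P \<cdot> h' = v' \<cdot> j"
    using pullback_lift[OF triv' _ _ comm] H' e v unfolding P_def by auto
  note H'' = H' homD[OF h'(1)]
  have hh: "h' \<cdot> \<chi> = h"
  proof (rule pullback_unique[OF triv', of _ Y])
    show "p \<cdot> (h' \<cdot> \<chi>) = p \<cdot> h" using cmp_cong_right1[OF h'(2), of \<chi>] h(2) H'' by simp
    show "\<eta> P \<cdot> (h' \<cdot> \<chi>) = \<eta> P \<cdot> h" using cmp_cong_right1[OF h'(3), of \<chi>] v\<chi> H'' by simp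
  qed (use H'' in \<open>auto simp: hom_def\<close>)
  have b: "q \<cdot> h' \<in> hom C (onObj Zr X) A" using cmp_hom[OF h'(1) q] .
  have "f \<cdot> (q \<cdot> h') \<in> null_arrows C \<Z>" using from_zero_null[OF ZX cmp_hom[OF b f]] .
  \<comment> \<open>An arrow out of a zero object is null after composition with \<open>f\<close>,
    so \<open>q h'\<close> lands in the kernel. Cancelling \<open>k\<close> then makes
    \<open>t_K r\<close> factor through \<open>Zr(X)\<close>, and so through the counit at
    \<open>K\<close>.\<close>
  then obtain l where l: "l \<in> hom C (onObj Zr X) K" "k \<cdot> l = q \<cdot> h'"
    using zkernel_universal[OF k] b unfolding A_def K_def by metis
  obtain l' where l': "l' \<in> hom C (onObj Zr X) (onObj Zr K)" "\<epsilon> K \<cdot> l' = l"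
    using from_zero_lift[OF ZX l(1)] .
  note \<epsilon>K = counit_hom[OF obj(5)]
  note G = H'' homD[OF l(1)] homD[OF l'(1)] homD[OF \<epsilon>K]
  have "k \<cdot> (l \<cdot> \<chi>) = q \<cdot> (h' \<cdot> \<chi>)" by (rule cmp_cong_right[OF l(2)]) (use G in simp_all)
  then have eq: "k \<cdot> (t K \<cdot> r) = k \<cdot> (l \<cdot> \<chi>)" using hh h(3) by simp
  have "t K \<cdot> r = l \<cdot> \<chi>"
    by (rule monoD[OF zkernel_mono[OF k], of _ Y]) (use eq G in \<open>simp_all add: hom_def\<close>)
  then have "t K \<cdot> r = \<epsilon> K \<cdot> (l' \<cdot> \<chi>)" using cmp_cong_right1[OF l'(2), of \<chi>] G by simp
  \<comment> \<open>The diagonal of the square formed by the regular epimorphism \<open>r\<close>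
    and the monic counit removes \<open>r\<close> and shows that \<open>t K\<close> itself is
    null.\<close>
  then obtain w where w: "w \<in> hom C T (onObj Zr K)" "\<epsilon> K \<cdot> w = t K"
    using regular_epi_strong[OF r_epi counit_mono[OF obj(5)], of "l' \<cdot> \<chi>" "t K"] G
    by (auto simp: hom_def)
  then have "t K \<in> null_arrows C \<Z>" using null_arrow_iff[OF t] by metis
  \<comment> \<open>Once \<open>t K\<close> is null, the identity of \<open>K\<close> factors
    through the cokernel \<open>\<eta> K\<close>, which yields the retraction that makes
    \<open>K\<close> torsion-free.\<close>
  then have "idn C K \<cdot> t K \<in> null_arrows C \<Z>" using G by simp
  then have "\<exists>!u. u \<in> hom C (F K) K \<and> u \<cdot> \<eta> K = idn C K"
    using unit_universal[OF obj(5) idn_hom[OF obj(5)]] by blast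
  then show ?thesis using unit_retraction_iso(2)[OF obj(5)] unfolding K_def by blast
qed

section \<open>From a torsion-free kernel to trivial kernel pair projections\<close>

text \<open>The pullback of \<open>p\<close> along the counit at \<open>A\<close> is torsion-free because \<open>K[f]\<close> is, and \<open>\<F>\<close> preserves it;
  so the comparison of \<open>p\<close> with the pullback of its reflection becomes invertible there.\<close>

lemma kernel_pair_projection_trivial:
  assumes pm: "protomodular C" and pbs: "has_pullbacks C" and Pc: "condition_P C Zr \<F> \<eta>"
    and f: "f \<in> hom C A B" and pb: "is_pullback C f f p q"
    and k: "is_zkernel C \<Z> f k" and K: "src C k \<in> \<F>"
  shows "is_pullback C (\<eta> A) (Fa p) p (\<eta> (src C p))"
proof -
  define P where "P = src C p"
  have p: "p \<in> hom C P A" and q: "q \<in> hom C P A" and fpq: "f \<cdot> p = f \<cdot> q"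
    using pullbackD[OF pb] homD[OF f] unfolding P_def by (auto simp: hom_def)
  have kh: "k \<in> hom C (src C k) A"
    using k homD[OF f] unfolding is_zkernel_def by (auto simp: hom_def)
  have obj: "A \<in> obj C" "B \<in> obj C" "P \<in> obj C" using homD[OF f] homD[OF p] by auto
  \<comment> \<open>The diagonal of the kernel pair is a section of \<open>p\<close>, so condition
    (P) and protomodularity can be applied to \<open>p\<close>.\<close>
  obtain s where s: "s \<in> hom C A P" "p \<cdot> s = idn C A"
    using pullback_lift[OF pb, of "idn C A" A "idn C A"] idn_hom[OF obj(1)] homD[OF f]
    unfolding P_def by auto
  have split: "is_split_epi C p s"
    using s homD[OF p] unfolding is_split_epi_def by simp
  note \<epsilon>A = counit_hom[OF obj(1)] and \<epsilon>B = counit_hom[OF obj(2)]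
    and ZA = coreflector_obj[OF obj(1)]
  note ZA' = zero_torsion_free[OF ZA] and ZAo = zero_obj[OF ZA]
  obtain n g where N: "is_pullback C (\<epsilon> A) p n g"
    using pbs homD[OF \<epsilon>A] homD[OF p] unfolding has_pullbacks_def by metis
  define X where "X = src C n"
  have n: "n \<in> hom C X (onObj Zr A)" and g: "g \<in> hom C X P" and nsq: "\<epsilon> A \<cdot> n = p \<cdot> g"
    using pullbackD[OF N] homD[OF \<epsilon>A] homD[OF p] unfolding X_def by auto
  have X: "X \<in> obj C" using homD[OF n] by auto
  note \<eta>X = torsion_sequence(6)[OF X] and \<eta>A = torsion_sequence(6)[OF obj(1)]
    and \<eta>P = torsion_sequence(6)[OF obj(3)] and \<eta>Z = torsion_sequence(6)[OF ZAo]
  note Fe = reflector_arr[OF \<epsilon>A] and Fp = reflector_arr[OF p] and Fn = reflector_arr[OF n]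
    and Fg = reflector_arr[OF g] and Zf = coreflector_arr[OF f]
  note H = homD[OF f] homD[OF p] homD[OF q] homD[OF kh] homD[OF s(1)] homD[OF \<epsilon>A] homD[OF \<epsilon>B] homD[OF n]
    homD[OF g] homD[OF \<eta>X] homD[OF \<eta>A] homD[OF \<eta>P] homD[OF \<eta>Z] homD[OF Fe(1)] homD[OF Fp(1)]
    homD[OF Fn(1)] homD[OF Fg(1)] homD[OF Zf(1)]

  \<comment> \<open>A retraction of \<open>\<eta> X\<close> is built. An arrow into \<open>X\<close>
    is determined by its components in \<open>Zr(A)\<close> and, through \<open>q\<close>, in
    \<open>K[f]\<close>; both targets are torsion-free, so the components of the identity extend to
    \<open>F X\<close>.\<close>
  have XF: "X \<in> \<F>"
  proof -
    have "f \<cdot> (q \<cdot> g) = f \<cdot> (p \<cdot> g)" by (rule cmp_cong_right[OF fpq[symmetric]]) (use H in simp_all)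
    also have "\<dots> = f \<cdot> (\<epsilon> A \<cdot> n)" using nsq by simp
    also have "\<dots> = \<epsilon> B \<cdot> (onArr Zr f \<cdot> n)"
      by (rule cmp_cong_right[OF Zf(2)[symmetric]]) (use H in simp_all)
    finally have "f \<cdot> (q \<cdot> g) \<in> null_arrows C \<Z>"
      using null_arrow_iff[OF cmp_hom[OF cmp_hom[OF g q] f]] cmp_hom[OF n Zf(1)] by blast
    then obtain l where l: "l \<in> hom C X (src C k)" "k \<cdot> l = q \<cdot> g"
      using zkernel_universal[OF k] cmp_hom[OF g q] homD[OF f] by metis
    obtain l' where l': "l' \<in> hom C (F X) (src C k)" "l' \<cdot> \<eta> X = l" using reflect[OF K l(1)] .
    obtain n' where n': "n' \<in> hom C (F X) (onObj Zr A)" "n' \<cdot> \<eta> X = n" using reflect[OF ZA' n] .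
    note G = H homD[OF l(1)] homD[OF l'(1)] homD[OF n'(1)]
    have "f \<cdot> (p \<cdot> g) = f \<cdot> (q \<cdot> g)" by (rule cmp_cong_right[OF fpq]) (use G in simp_all)
    then have "(f \<cdot> (\<epsilon> A \<cdot> n')) \<cdot> \<eta> X = (f \<cdot> (k \<cdot> l')) \<cdot> \<eta> X"
      using n'(2) l'(2) l(2) nsq G by simp
    \<comment> \<open>The extended components agree over \<open>B\<close> because they do so after
      the epimorphism \<open>\<eta> X\<close>; hence they pair first into \<open>P\<close> and then
      into \<open>X\<close>.\<close>
    then have "f \<cdot> (\<epsilon> A \<cdot> n') = f \<cdot> (k \<cdot> l')"
      by (rule unit_epi[OF X, of _ B, rotated 2]) (use G in \<open>simp_all add: hom_def\<close>)
    then obtain d where d: "d \<in> hom C (F X) P" "p \<cdot> d = \<epsilon> A \<cdot> n'" "q \<cdot> d = k \<cdot> l'"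
      using pullback_lift[OF pb, of "\<epsilon> A \<cdot> n'" "F X" "k \<cdot> l'"] G by (auto simp: hom_def)
    obtain r where r: "r \<in> hom C (F X) X" "n \<cdot> r = n'" "g \<cdot> r = d"
      using pullback_lift[OF N _ _ d(2)[symmetric]] n'(1) d(1) G by auto
    note G' = G homD[OF d(1)] homD[OF r(1)]
    have d\<eta>: "d \<cdot> \<eta> X = g"
    proof (rule pullback_unique[OF pb, of _ X])
      show "p \<cdot> (d \<cdot> \<eta> X) = p \<cdot> g" using cmp_cong_right1[OF d(2), of "\<eta> X"] n'(2) nsq G' by simp
      show "q \<cdot> (d \<cdot> \<eta> X) = q \<cdot> g" using cmp_cong_right1[OF d(3), of "\<eta> X"] l'(2) l(2) G' by simp
    qed (use G' in \<open>auto simp: hom_def\<close>)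
    have "r \<cdot> \<eta> X = idn C X"
    proof (rule pullback_unique[OF N, of _ X])
      show "n \<cdot> (r \<cdot> \<eta> X) = n \<cdot> idn C X" using cmp_cong_right1[OF r(2), of "\<eta> X"] n'(2) X G' by simp
      show "g \<cdot> (r \<cdot> \<eta> X) = g \<cdot> idn C X" using cmp_cong_right1[OF r(3), of "\<eta> X"] d\<eta> X G' by simp
    qed (use G' X in \<open>auto simp: hom_def\<close>)
    then show ?thesis using unit_retraction_iso(2)[OF X r(1)] by blast
  qed

  \<comment> \<open>The counit is monic and hence inverted by \<open>Zr\<close>, so condition (P)
    covers the pullback of the split epimorphism \<open>p\<close> along it.\<close>
  have FN: "is_pullback C (Fa (\<epsilon> A)) (Fa p) (Fa n) (Fa g)"
    using Pc split N coreflector_mono[OF counit_mono[OF obj(1)]] torsion_free_pullback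
    unfolding condition_P_def by blast
  obtain \<pi> \<rho> where R: "is_pullback C (\<eta> A) (Fa p) \<pi> \<rho>"
    using pbs homD[OF \<eta>A] homD[OF Fp(1)] unfolding has_pullbacks_def by metis
  define Q where "Q = src C \<pi>"
  have \<pi>: "\<pi> \<in> hom C Q A" and \<rho>: "\<rho> \<in> hom C Q (F P)" and rsq: "\<eta> A \<cdot> \<pi> = Fa p \<cdot> \<rho>"
    using pullbackD[OF R] homD[OF \<eta>A] homD[OF Fp(1)] unfolding Q_def by auto
  note H1 = H homD[OF \<pi>] homD[OF \<rho>]
  \<comment> \<open>The comparison from \<open>p\<close> to the pullback of \<open>Fa p\<close>
    along the unit; the claim amounts to its invertibility.\<close>
  obtain \<phi> where \<phi>: "\<phi> \<in> hom C P Q" "\<pi> \<cdot> \<phi> = p" "\<rho> \<cdot> \<phi> = \<eta> P"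
    using pullback_lift[OF R _ _ Fp(2)[symmetric]] p \<eta>P H1 by auto
  obtain m where m: "m \<in> hom C (F X) X" "\<eta> X \<cdot> m = idn C (F X)"
    using isoE[OF unit_iso[OF XF]] H by metis
  note H2 = H1 homD[OF \<phi>(1)] homD[OF m(1)]
  have \<pi>\<phi>g: "\<pi> \<cdot> (\<phi> \<cdot> x) = p \<cdot> x" and \<rho>\<phi>g: "\<rho> \<cdot> (\<phi> \<cdot> x) = \<eta> P \<cdot> x" if "x \<in> hom C Y P" for x Y
    using cmp_cong_right1[OF \<phi>(2), of x] cmp_cong_right1[OF \<phi>(3), of x] homD[OF that] H2 by simp_all
  have nat_n: "\<eta> (onObj Zr A) \<cdot> (n \<cdot> y) = Fa n \<cdot> (\<eta> X \<cdot> y)"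
    and nat_g: "\<eta> P \<cdot> (g \<cdot> y) = Fa g \<cdot> (\<eta> X \<cdot> y)" if "y \<in> hom C Y X" for y Y
    using cmp_cong_right[OF Fn(2), of y] cmp_cong_right[OF Fg(2), of y] homD[OF that] H2 by simp_all
  \<comment> \<open>\<open>\<pi>\<close> has the same pullback along the counit as \<open>p\<close>:
    pasting identifies it with the reflected square \<open>FN\<close>, which agrees with
    \<open>X\<close> because the units at \<open>X\<close> and at \<open>Zr(A)\<close> are
    invertible.\<close>
  have N': "is_pullback C (\<epsilon> A) \<pi> n (\<phi> \<cdot> g)"
  proof (rule pullbackI[OF \<epsilon>A \<pi> n cmp_hom[OF g \<phi>(1)]])
    show "\<epsilon> A \<cdot> n = \<pi> \<cdot> (\<phi> \<cdot> g)" using nsq \<pi>\<phi>g[OF g] by simp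
  next
    fix Y u w assume u: "u \<in> hom C Y (onObj Zr A)" and w: "w \<in> hom C Y Q" and uw: "\<epsilon> A \<cdot> u = \<pi> \<cdot> w"
    note U = homD[OF u] homD[OF w]
    have "Fa (\<epsilon> A) \<cdot> (\<eta> (onObj Zr A) \<cdot> u) = \<eta> A \<cdot> (\<epsilon> A \<cdot> u)"
      by (rule cmp_cong_right[OF Fe(2)]) (use H2 U in simp_all)
    also have "\<dots> = \<eta> A \<cdot> (\<pi> \<cdot> w)" using uw by simp
    also have "\<dots> = Fa p \<cdot> (\<rho> \<cdot> w)" by (rule cmp_cong_right[OF rsq]) (use H2 U in simp_all)
    finally obtain x where x: "x \<in> hom C Y (F X)" "Fa n \<cdot> x = \<eta> (onObj Zr A) \<cdot> u" "Fa g \<cdot> x = \<rho> \<cdot> w"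
      using pullback_lift[OF FN, of "\<eta> (onObj Zr A) \<cdot> u" Y "\<rho> \<cdot> w"] cmp_hom[OF u \<eta>Z] cmp_hom[OF w \<rho>] H2 by auto
    \<comment> \<open>The mediating arrow comes from the reflected pullback and is carried back to
      \<open>X\<close> by \<open>m\<close>, the inverse of the unit.\<close>
    have y: "m \<cdot> x \<in> hom C Y X" using cmp_hom[OF x(1) m(1)] .
    note G = H2 U homD[OF x(1)] homD[OF y]
    have \<eta>y: "\<eta> X \<cdot> (m \<cdot> x) = x" using cmp_cong_right1[OF m(2), of x] G by simp
    have ny: "n \<cdot> (m \<cdot> x) = u"
      by (rule monoD[OF iso_mono[OF unit_iso[OF ZA']], of _ Y])
        (use nat_n[OF y] \<eta>y x(2) G in \<open>simp_all add: hom_def\<close>)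
    have "(\<phi> \<cdot> g) \<cdot> (m \<cdot> x) = w"
    proof (rule pullback_unique[OF R, of _ Y])
      have gy: "g \<cdot> (m \<cdot> x) \<in> hom C Y P" using cmp_hom[OF y g] .
      have "p \<cdot> (g \<cdot> (m \<cdot> x)) = \<epsilon> A \<cdot> (n \<cdot> (m \<cdot> x))"
        by (rule cmp_cong_right[OF nsq[symmetric]]) (use G in simp_all)
      then show "\<pi> \<cdot> ((\<phi> \<cdot> g) \<cdot> (m \<cdot> x)) = \<pi> \<cdot> w" using \<pi>\<phi>g[OF gy] ny uw G by simp
      show "\<rho> \<cdot> ((\<phi> \<cdot> g) \<cdot> (m \<cdot> x)) = \<rho> \<cdot> w" using \<rho>\<phi>g[OF gy] nat_g[OF y] \<eta>y x(3) G by simp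
    qed (use G in \<open>simp_all add: hom_def\<close>)
    then show "\<exists>y\<in>hom C Y X. n \<cdot> y = u \<and> (\<phi> \<cdot> g) \<cdot> y = w" using ny y by blast
  next
    fix Y y y' assume y: "y \<in> hom C Y X" and y': "y' \<in> hom C Y X" and eq: "n \<cdot> y = n \<cdot> y'"
      "(\<phi> \<cdot> g) \<cdot> y = (\<phi> \<cdot> g) \<cdot> y'"
    note G = H2 homD[OF y] homD[OF y']
    have "\<phi> \<cdot> (g \<cdot> y) = \<phi> \<cdot> (g \<cdot> y')" using eq(2) G by simp
    then have "\<eta> P \<cdot> (g \<cdot> y) = \<eta> P \<cdot> (g \<cdot> y')"
      using \<rho>\<phi>g[OF cmp_hom[OF y g]] \<rho>\<phi>g[OF cmp_hom[OF y' g]] by simp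
    then have "Fa n \<cdot> (\<eta> X \<cdot> y) = Fa n \<cdot> (\<eta> X \<cdot> y')" "Fa g \<cdot> (\<eta> X \<cdot> y) = Fa g \<cdot> (\<eta> X \<cdot> y')"
      using nat_n[OF y] nat_n[OF y'] nat_g[OF y] nat_g[OF y'] eq(1) by simp_all
    then have "\<eta> X \<cdot> y = \<eta> X \<cdot> y'"
      by (rule pullback_unique[OF FN, of _ Y, rotated 2]) (use G in \<open>simp_all add: hom_def\<close>)
    then show "y = y'"
      by (rule monoD[OF iso_mono[OF unit_iso[OF XF]], of _ Y, rotated 2])
        (use G in \<open>simp_all add: hom_def\<close>)
  qed
  have \<phi>h: "\<phi> \<in> hom C (src C p) (src C \<pi>)" using \<phi>(1) H2 by simp
  have "is_iso C \<phi>"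
    using protomodular_conservative[OF pm pbs split \<phi>h homD(1)[OF \<pi>] \<phi>(2) N N'] .
  then have "is_pullback C (\<eta> A) (Fa p) (\<pi> \<cdot> \<phi>) (\<rho> \<cdot> \<phi>)"
    using pullback_iso[OF R] H2 by simp
  then show ?thesis using \<phi>(2,3) H by simp
qed

end

theorem theorem4p17:
  fixes C :: "('o, 'm) cat"
    and \<Z> \<T> \<F> :: "'o set"
    and Zr :: "('o, 'm, 'o, 'm) func"
    and \<epsilon> t \<eta> :: "'o \<Rightarrow> 'm"
    and f :: 'm
  assumes "barr_exact C"
    and "protomodular C"
    and "class_of_zero_objects C \<Z> Zr \<epsilon>"
    and "torsion_theory C \<Z> \<T> \<F> t \<eta>"
    and "condition_S C \<Z> \<T> \<eta>"
    and "condition_M' C Zr t \<eta>"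
    and "condition_P C Zr \<F> \<eta>"
    and "effective_descent C f"
  shows "(normal_extension C (reflector C \<eta>) id_func \<eta> f
            \<longleftrightarrow> central_extension C (reflector C \<eta>) id_func \<eta> f)
       \<and> (central_extension C (reflector C \<eta>) id_func \<eta> f
            \<longleftrightarrow> zker_obj C \<Z> f \<in> \<F>)"
proof -
  have reg: "regular_category C" using assms(1) unfolding barr_exact_def by blast
  have pbs: "has_pullbacks C" and "category C"
    using reg unfolding regular_category_def finitely_complete_def by blast+
  then interpret category C by blast
  interpret zero_torsion_theory C \<Z> Zr \<epsilon> \<T> \<F> t \<eta>
    by unfold_locales (fact assms)+
  have f: "f \<in> hom C (src C f) (tgt C f)"
    using assms(8) unfolding effective_descent_def by (simp add: hom_def)
  define k where "k = (SOME k. is_zkernel C \<Z> f k)"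
  have k: "is_zkernel C \<Z> f k" and K: "zker_obj C \<Z> f = src C k"
    unfolding k_def zker_obj_def using zkernel_exists[OF pbs f] by (auto intro: someI_ex)
  have kp: "is_pullback C f f (pb1 C f f) (pb2 C f f)"
    using pb_is_pullback[OF pbs] homD(1)[OF f] by blast
  \<comment> \<open>A normal extension splits itself: \<open>f\<close> serves as the effective
    descent morphism along which it is pulled back.\<close>
  have nc: "central_extension C (reflector C \<eta>) id_func \<eta> f"
    if "normal_extension C (reflector C \<eta>) id_func \<eta> f"
    using that homD(1)[OF f] unfolding normal_extension_def central_extension_def by blast
  have ck: "src C k \<in> \<F>" if ce: "central_extension C (reflector C \<eta>) id_func \<eta> f"
  proof -
    obtain g where "effective_descent C g" and g: "tgt C g = tgt C f"
      and tr: "trivial_extension C (reflector C \<eta>) id_func \<eta> (pb1 C g f)"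
      using ce unfolding central_extension_def by blast
    then have "is_pullback C g f (pb1 C g f) (pb2 C g f)"
      using pb_is_pullback[OF pbs] homD(1)[OF f] unfolding effective_descent_def by blast
    moreover from this have "tgt C (pb1 C g f) = src C g" using homD(3) pullbackD(3) by metis
    ultimately show ?thesis
      using kernel_torsion_free_if_trivial_pullback[OF reg assms(5) _ _ k] tr
      unfolding trivial_extension_def id_func_def by simp
  qed
  have kn: "normal_extension C (reflector C \<eta>) id_func \<eta> f" if "src C k \<in> \<F>"
  proof -
    \<comment> \<open>Stated for every kernel pair of \<open>f\<close>, so that the symmetric square
      yields the second projection as well.\<close>
    have "trivial_extension C (reflector C \<eta>) id_func \<eta> p" if "is_pullback C f f p q" for p q
      using kernel_pair_projection_trivial[OF assms(2) pbs assms(7) f that k \<open>src C k \<in> \<F>\<close>]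
        homD[OF pullbackD(3)[OF that]]
      unfolding trivial_extension_def id_func_def by simp
    then show ?thesis
      using kp pullback_sym[OF kp] assms(8) unfolding normal_extension_def by blast
  qed
  show ?thesis unfolding K using nc ck kn by blast
qed

end
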